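(* Let $X$ be a random variable with values in a set $\mathcal X$ with distribution $\mu$ and let $\mathcal F$ be a class of hypotheses $f:\mathcal X\to[0,1]$. Fix $\delta\in(0,1)$, $n\ge 16$ and set $\mathcal M(n)=10\,\mathcal N_\infty(1/n,\mathcal F,2n)$. Then with probability at least $1-\delta$ in the random vector $\mathbf X=(X_1,\dots,X_n)\sim\mu^n$ we have $$P(f,\mu)-P_n(f,\mathbf X)\le\sqrt{\frac{18V_n(f,\mathbf X)\ln(\mathcal M(n)/\delta)}{n}}+\frac{15\ln(\mathcal M(n)/\delta)}{n-1}\qquad\text{for all } f\in\mathcal F.$$
   Context: $\mathbf X\sim\mu^n$ means that $X_1,\dots,X_n$ are i.i.d. with distribution $\mu$. For $f:\mathcal X\to[0,1]$ and $\mathbf x=(x_1,\dots,x_n)\in\mathcal X^n$: $P(f,\mu)=\mathbb E_{X\sim\mu}f(X)$; $P_n(f,\mathbf x)=\frac1n\sum_{i=1}^n f(x_i)$; $V_n(f,\mathbf x)=\frac{1}{n(n-1)}\sum_{1\le i<j\le n}(f(x_i)-f(x_j))^2$. Growth function: for $\epsilon>0$ and an integer $m\ge1$, $$\mathcal N_\infty(\epsilon,\mathcal F,m)=\sup_{\mathbf x\in\mathcal X^m}\mathcal N(\epsilon,\mathcal F(\mathbf x),\|\cdot\|_\infty),$$ where $\mathcal F(\mathbf x)=\{(f(x_1),\dots,f(x_m)):f\in\mathcal F\}\subseteq\mathbb R^m$ and, for $A\subseteq\mathbb R^m$, $\mathcal N(\epsilon,A,\|\cdot\|_\infty)$ is the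 smallest cardinality $|A_0|$ of a set $A_0\subseteq A$ such that $A$ is contained in the union of the $\epsilon$-balls centered at points of $A_0$, in the metric induced by $\|\cdot\|_\infty$. Questions of measurability are ignored: all functions and events involved are assumed measurable (if necessary this is enforced through finiteness assumptions). *)

theory Defs
  imports "HOL-Probability.Probability"
begin

text \<open>
  The set of instances is \<open>space M\<close> for a probability measure \<open>M\<close>.  A sample of size \<open>m\<close> is an
  element of \<open>{..<m} \<rightarrow>\<^sub>E space M\<close>, i.e. coordinates are indexed from \<open>0\<close>, and the law of an
  i.i.d. sample is the product measure below.
\<close>

abbreviation sample_measure :: "'a measure \<Rightarrow> nat \<Rightarrow> (nat \<Rightarrow> 'a) measure"
  where "sample_measure M m \<equiv> PiM {..<m} (\<lambda>_. M)"

abbreviation true_mean :: "('a \<Rightarrow> real) \<Rightarrow> 'a measure \<Rightarrow> real"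
  where "true_mean f M \<equiv> (\<integral>z. f z \<partial>M)"

definition emp_mean :: "nat \<Rightarrow> ('a \<Rightarrow> real) \<Rightarrow> (nat \<Rightarrow> 'a) \<Rightarrow> real"
  where "emp_mean n f x = 1 / real n * (\<Sum>i<n. f (x i))"

definition emp_var :: "nat \<Rightarrow> ('a \<Rightarrow> real) \<Rightarrow> (nat \<Rightarrow> 'a) \<Rightarrow> real"
  where "emp_var n f x =
    1 / (real n * (real n - 1)) * (\<Sum>j<n. \<Sum>i<j. (f (x i) - f (x j))\<^sup>2)"


text \<open>
  Vectors of length \<open>m\<close> are functions of which only the coordinates \<open>i < m\<close> matter.
\<close>

definition linf_dist :: "nat \<Rightarrow> (nat \<Rightarrow> real) \<Rightarrow> (nat \<Rightarrow> real) \<Rightarrow> real"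
  where "linf_dist m v w = (MAX i\<in>{..<m}. \<bar>v i - w i\<bar>)"

text \<open>
  Closed balls are used.  Since open balls give covering numbers that are at least as large,
  an upper bound that increases with the covering number is strongest with this convention.
\<close>

definition linf_covers :: "nat \<Rightarrow> real \<Rightarrow> (nat \<Rightarrow> real) set \<Rightarrow> (nat \<Rightarrow> real) set \<Rightarrow> bool"
  where "linf_covers m \<epsilon> A\<^sub>0 A \<longleftrightarrow> A\<^sub>0 \<subseteq> A \<and> A \<subseteq> (\<Union>a\<in>A\<^sub>0. {v. linf_dist m a v \<le> \<epsilon>})"

definition covering_number :: "nat \<Rightarrow> real \<Rightarrow> (nat \<Rightarrow> real) set \<Rightarrow> enat"
  where "covering_number m \<epsilon> A = (INF A\<^sub>0\<in>{A\<^sub>0. finite A\<^sub>0 \<and> linf_covers m \<epsilon> A\<^sub>0 A}. enat (card A\<^sub>0))"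

definition class_on_sample :: "nat \<Rightarrow> ('a \<Rightarrow> real) set \<Rightarrow> (nat \<Rightarrow> 'a) \<Rightarrow> (nat \<Rightarrow> real) set"
  where "class_on_sample m F x = (\<lambda>f. \<lambda>i\<in>{..<m}. f (x i)) ` F"

definition growth_function :: "'a set \<Rightarrow> real \<Rightarrow> ('a \<Rightarrow> real) set \<Rightarrow> nat \<Rightarrow> enat"
  where "growth_function S \<epsilon> F m =
    (SUP x\<in>({..<m} \<rightarrow>\<^sub>E S). covering_number m \<epsilon> (class_on_sample m F x))"

text \<open>
  For classes of functions into the unit interval the growth function is finite, so that
  \<open>the_enat\<close> may be applied to it.
\<close>

lemma covering_number_unit_cube:
  assumes "m > 0" "real K > 0" "1 / real K \<le> \<epsilon>"
    and A: "\<And>v i. v \<in> A \<Longrightarrow> i < m \<Longrightarrow> v i \<in> {0..1}"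
  shows "covering_number m \<epsilon> A \<le> enat ((K + 1) ^ m)"
proof -
  define c where "c = (\<lambda>v :: nat \<Rightarrow> real. \<lambda>i\<in>{..<m}. nat \<lfloor>v i * real K\<rfloor>)"
  define A\<^sub>0 where "A\<^sub>0 = inv_into A c ` c ` A"
  have cA: "c ` A \<subseteq> {..<m} \<rightarrow>\<^sub>E {..K}"
  proof (clarsimp simp: c_def)
    fix v i assume "v \<in> A" "i < m"
    then have "v i * real K \<le> real K"
      using A[of v i] by (intro mult_left_le_one_le) auto
    then show "nat \<lfloor>v i * real K\<rfloor> \<le> K" by linarith
  qed
  have fin: "finite ({..<m} \<rightarrow>\<^sub>E {..K})" by (intro finite_PiE) auto
  have "card (c ` A) \<le> (K + 1) ^ m"
    using card_mono[OF fin cA] by (simp add: card_PiE)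
  moreover have finc: "finite (c ` A)" using cA fin by (rule finite_subset)
  ultimately have card: "card A\<^sub>0 \<le> (K + 1) ^ m"
    unfolding A\<^sub>0_def using card_image_le[OF finc] by (meson order_trans)
  have "linf_covers m \<epsilon> A\<^sub>0 A"
    unfolding linf_covers_def
  proof (intro conjI subsetI)
    fix v assume "v \<in> A\<^sub>0"
    then show "v \<in> A" unfolding A\<^sub>0_def by (auto intro: inv_into_into)
  next
    fix v assume v: "v \<in> A"
    define a where "a = inv_into A c (c v)"
    have a: "a \<in> A" "c a = c v" "a \<in> A\<^sub>0"
      using v unfolding a_def A\<^sub>0_def by (auto intro: inv_into_into simp: f_inv_into_f)
    have "\<bar>a i - v i\<bar> \<le> \<epsilon>" if i: "i < m" for i
    proof -
      have "nat \<lfloor>a i * real K\<rfloor> = nat \<lfloor>v i * real K\<rfloor>"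
        using fun_cong[OF a(2), of i] i by (simp add: c_def)
      moreover have "0 \<le> a i * real K" "0 \<le> v i * real K"
        using A[OF a(1) i] A[OF v i] by auto
      ultimately have "\<lfloor>a i * real K\<rfloor> = \<lfloor>v i * real K\<rfloor>" by linarith
      then have "\<bar>a i * real K - v i * real K\<bar> \<le> 1" by linarith
      then have "\<bar>a i - v i\<bar> * real K \<le> 1"
        by (simp add: left_diff_distrib[symmetric] abs_mult)
      then have "\<bar>a i - v i\<bar> \<le> 1 / real K"
        using assms(2) by (simp add: field_simps)
      then show ?thesis using assms(3) by linarith
    qed
    then have "linf_dist m a v \<le> \<epsilon>"
      using assms(1) unfolding linf_dist_def by (subst Max_le_iff) auto
    then show "v \<in> (\<Union>a\<in>A\<^sub>0. {v. linf_dist m a v \<le> \<epsilon>})" using a(3) by auto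
  qed
  moreover have "finite A\<^sub>0" using finc by (simp add: A\<^sub>0_def)
  ultimately have "covering_number m \<epsilon> A \<le> enat (card A\<^sub>0)"
    unfolding covering_number_def by (intro INF_lower) auto
  also have "\<dots> \<le> enat ((K + 1) ^ m)" using card by simp
  finally show ?thesis .
qed

lemma growth_function_finite:
  assumes "m > 0" "\<epsilon> > 0" and F: "\<And>f z. f \<in> F \<Longrightarrow> z \<in> S \<Longrightarrow> f z \<in> {0..1}"
  shows "growth_function S \<epsilon> F m < \<infinity>"
proof -
  obtain K :: nat where "1 / \<epsilon> < real K" using reals_Archimedean2 by blast
  moreover have "0 < 1 / \<epsilon>" using assms by simp
  ultimately have K: "real K > 0" "1 / real K \<le> \<epsilon>"
    using assms(2) by (linarith, simp add: divide_simps mult.commute split: if_splits)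
  have "growth_function S \<epsilon> F m \<le> enat ((K + 1) ^ m)"
    unfolding growth_function_def
  proof (intro SUP_least covering_number_unit_cube assms(1) K)
    fix x v i assume x: "x \<in> {..<m} \<rightarrow>\<^sub>E S" and v: "v \<in> class_on_sample m F x" and i: "i < m"
    obtain f where "f \<in> F" "v i = f (x i)"
      using v i by (auto simp: class_on_sample_def)
    moreover have "x i \<in> S" using PiE_mem[OF x] i by simp
    ultimately show "v i \<in> {0..1}" using F by metis
  qed
  then show ?thesis by (rule order_le_less_trans) simp
qed


text \<open>
  Measurability of the events attached to samples of size \<open>m\<close>: whenever \<open>U\<close> is open, it is an event
  that some \<open>f \<in> F\<close> has its expectation and its values at the sample points in \<open>U\<close>.
  Measurability of the single functions alone would not do: without such a condition an
  uncountable class of bounded growth can violate uniform laws of large numbers.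
\<close>

definition sample_events_measurable :: "'a measure \<Rightarrow> ('a \<Rightarrow> real) set \<Rightarrow> nat \<Rightarrow> bool"
  where "sample_events_measurable M F m \<longleftrightarrow>
    (\<forall>U :: (real \<times> (nat \<Rightarrow> real)) set. open U \<longrightarrow>
      {x \<in> space (sample_measure M m).
        \<exists>f\<in>F. (true_mean f M, \<lambda>i. if i < m then f (x i) else 0) \<in> U} \<in> sets (sample_measure M m))"

lemma sample_events_measurable_countable:
  assumes "countable F" and F: "\<And>f. f \<in> F \<Longrightarrow> f \<in> borel_measurable M"
  shows "sample_events_measurable M F m"
  unfolding sample_events_measurable_def
proof (intro allI impI)
  fix U :: "(real \<times> (nat \<Rightarrow> real)) set" assume U: "open U"
  let ?g = "\<lambda>f x. (true_mean f M, \<lambda>i. if i < m then f (x i) else 0)"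
  have "?g f \<in> borel_measurable (sample_measure M m)" if "f \<in> F" for f
  proof (intro borel_measurable_Pair borel_measurable_const measurable_coordinatewise_then_product)
    fix i show "(\<lambda>x. if i < m then f (x i) else 0) \<in> borel_measurable (sample_measure M m)"
      using F[OF that] by (cases "i < m") (auto intro!: measurable_compose[OF measurable_component_singleton])
  qed
  then have "?g f -` U \<inter> space (sample_measure M m) \<in> sets (sample_measure M m)" if "f \<in> F" for f
    using that U by (intro measurable_sets[of _ _ borel]) auto
  then have "(\<Union>f\<in>F. ?g f -` U \<inter> space (sample_measure M m)) \<in> sets (sample_measure M m)"
    using assms(1) by (intro sets.countable_UN') auto
  also have "(\<Union>f\<in>F. ?g f -` U \<inter> space (sample_measure M m)) =
      {x \<in> space (sample_measure M m). \<exists>f\<in>F. ?g f x \<in> U}" by auto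
  finally show "{x \<in> space (sample_measure M m). \<exists>f\<in>F. ?g f x \<in> U} \<in> sets (sample_measure M m)" .
qed

end

theory Submission
  imports Defs
begin

text \<open>
  With \<open>t = ln (\<M> / \<delta>)\<close>, symmetrize with a ghost sample. By Chebyshev's inequality, with probability
  at least \<open>1/5\<close> the ghost sample has mean at least \<open>P(f) - 7/5 \<sigma> / sqrt n\<close> and second moment about
  \<open>P(f)\<close> at least \<open>\<sigma>\<^sup>2 - 2 \<sigma> / sqrt n\<close>; then \<open>\<sigma>\<close> is controlled by the sum \<open>T\<close> of squared deviations
  of all \<open>2n\<close> values from their mean, and a violation of the bound forces
  \<open>n (P\<^sub>n(f, X') - P\<^sub>n(f, X)) + sqrt (t T) + 16/5 > sqrt (18 t W) + 15 t\<close>, where \<open>W = (n - 1) V\<^sub>n(f, X)\<close>.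
  This event depends only on the \<open>2n\<close> values of \<open>f\<close>, so conditionally on the double sample \<open>f\<close> may be
  replaced by an element of a finite cover.  For a fixed vector, exchanging \<open>X\<^sub>i\<close> and \<open>X'\<^sub>i\<close> at random
  leaves \<open>T\<close> invariant, while both the difference of the means and the difference of the two halves
  of \<open>T\<close> become Rademacher sums with variance proxies \<open>2 T\<close> and \<open>T\<close>.  So with probability
  \<open>1 - 2 exp (- t)\<close> we have \<open>n\<close> times the former at most \<open>2 sqrt (t T)\<close>, and \<open>T\<close> at most
  \<open>2 S + sqrt (2 t T)\<close>, \<open>S\<close> being the half of \<open>T\<close> that belongs to the sample, whence
  \<open>3 sqrt (t T) \<le> sqrt (18 t S) + 3 sqrt 2 t\<close>.  Passing from \<open>S\<close> to \<open>W\<close> and from the cover back to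
  \<open>f\<close> only costs a further multiple of \<open>t\<close>, for which \<open>15 t\<close> leaves room.
  The factor \<open>10\<close> is \<open>5 * 2\<close>.
\<close>

section \<open>Rademacher sums\<close>

text \<open>Hoeffding's lemma for a fair sign: the auxiliary inequality is used with
  \<open>2 * y\<close> and weight \<open>1/2\<close>. Evenness of \<open>cosh\<close> covers
  negative arguments.\<close>

lemma cosh_le_exp_square_half: "cosh x \<le> exp (x\<^sup>2 / 2)" for x :: real
proof -
  have *: "cosh y \<le> exp (y\<^sup>2 / 2)" if y: "y \<ge> 0" for y :: real
  proof -
    define p where "p = 1 + 1/2 * (exp (2 * y) - 1)"
    have p: "p > 0" by (simp add: p_def field_simps add_pos_pos)
    have "exp (- y) * exp (2 * y) = exp y" by (simp flip: exp_add)
    then have "cosh y = exp (- y) * p"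
      by (simp add: cosh_def p_def algebra_simps)
    also have "\<dots> = exp (- (2 * y) * (1/2) + ln p)"
      using p by (subst exp_add) simp
    also have "\<dots> \<le> exp ((2 * y)\<^sup>2 / 8)"
      unfolding exp_le_cancel_iff p_def by (rule Hoeffdings_lemma_aux) (use y in auto)
    finally show ?thesis by (simp add: power2_eq_square)
  qed
  show ?thesis using *[of "\<bar>x\<bar>"] by (cases "x \<ge> 0") auto
qed

text \<open>\<open>A\<close> lists the indices with negative sign, so counting subsets
  \<open>A\<close> of \<open>I\<close> and dividing by \<open>2 ^ card I\<close> gives probabilities
  for independent Rademacher signs.\<close>

definition signed_sum :: "'i set \<Rightarrow> 'i set \<Rightarrow> ('i \<Rightarrow> real) \<Rightarrow> real"
  where "signed_sum I A d = (\<Sum>i\<in>I. if i \<in> A then - d i else d i)"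

text \<open>The moment generating function, up to normalization: \<open>prod_add\<close> factorizes
  the sum over all sign patterns into terms \<open>2 * cosh (l * d i)\<close>.\<close>

lemma sum_exp_signed_sum_le:
  assumes "finite I"
  shows "(\<Sum>A\<in>Pow I. exp (l * signed_sum I A d)) \<le> 2 ^ card I * exp (l\<^sup>2 * (\<Sum>i\<in>I. (d i)\<^sup>2) / 2)"
proof -
  have "exp (l * signed_sum I A d) = (\<Prod>i\<in>A. exp (- (l * d i))) * (\<Prod>i\<in>I - A. exp (l * d i))"
    if "A \<subseteq> I" for A
  proof -
    have "exp (l * signed_sum I A d) = (\<Prod>i\<in>I. exp (l * (if i \<in> A then - d i else d i)))"
      using assms by (simp add: signed_sum_def sum_distrib_left exp_sum)
    also have "\<dots> = (\<Prod>i\<in>I - A. exp (l * (if i \<in> A then - d i else d i))) *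
        (\<Prod>i\<in>A. exp (l * (if i \<in> A then - d i else d i)))"
      using that assms by (rule prod.subset_diff)
    finally show ?thesis by (simp add: mult.commute)
  qed
  then have "(\<Sum>A\<in>Pow I. exp (l * signed_sum I A d)) =
      (\<Sum>A\<in>Pow I. (\<Prod>i\<in>A. exp (- (l * d i))) * (\<Prod>i\<in>I - A. exp (l * d i)))"
    by (intro sum.cong) auto
  also have "\<dots> = (\<Prod>i\<in>I. exp (- (l * d i)) + exp (l * d i))"
    using assms by (rule prod_add[symmetric])
  also have "\<dots> = (\<Prod>i\<in>I. 2 * cosh (l * d i))"
    by (simp add: cosh_def algebra_simps)
  also have "\<dots> \<le> (\<Prod>i\<in>I. 2 * exp ((l * d i)\<^sup>2 / 2))"
    by (intro prod_mono) (simp add: cosh_le_exp_square_half)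
  also have "\<dots> = 2 ^ card I * exp (\<Sum>i\<in>I. (l * d i)\<^sup>2 / 2)"
    using assms by (simp add: prod.distrib exp_sum)
  also have "(\<Sum>i\<in>I. (l * d i)\<^sup>2 / 2) = l\<^sup>2 * (\<Sum>i\<in>I. (d i)\<^sup>2) / 2"
    by (simp add: sum_distrib_left sum_divide_distrib power_mult_distrib)
  finally show ?thesis .
qed

lemma card_signed_sum_gt_le:
  assumes I: "finite I" and t: "t \<ge> 0" and B: "(\<Sum>i\<in>I. (d i)\<^sup>2) \<le> B"
  shows "real (card {A\<in>Pow I. signed_sum I A d > sqrt (2 * t * B)}) \<le> 2 ^ card I * exp (- t)"
proof -
  define D where "D = (\<Sum>i\<in>I. (d i)\<^sup>2)"
  define G where "G = {A\<in>Pow I. signed_sum I A d > sqrt (2 * t * B)}"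
  have finG: "finite G" using I by (simp add: G_def)
  have D0: "D \<ge> 0" by (simp add: D_def sum_nonneg)
  show ?thesis
  proof (cases "D = 0")
    case True
    then have "\<forall>i\<in>I. d i = 0" using I by (simp add: D_def sum_nonneg_eq_0_iff)
    then have "signed_sum I A d = 0" for A by (auto simp: signed_sum_def intro!: sum.neutral)
    moreover have "sqrt (2 * t * B) \<ge> 0" using t B D0 by (simp add: D_def)
    ultimately have "G = {}" by (auto simp: G_def not_less)
    then show ?thesis unfolding G_def[symmetric] by simp
  next
    case False
    then have D: "D > 0" using D0 by simp
    \<comment> \<open>The Chernoff parameter: the exponent is \<open>2 * t\<close> at the threshold
      and \<open>t\<close> in the moment bound, leaving \<open>exp (- t)\<close>. The division is
      why \<open>D = 0\<close> is treated apart.\<close>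
    define l where "l = sqrt (2 * t / D)"
    have l2: "l\<^sup>2 * D = 2 * t" using t D by (simp add: l_def)
    have l0: "l \<ge> 0" using t D by (simp add: l_def)
    have "l * sqrt (2 * t * D) = sqrt ((2 * t)\<^sup>2)"
      unfolding l_def real_sqrt_mult[symmetric] using D by (simp add: power2_eq_square)
    then have "l * sqrt (2 * t * D) = 2 * t"
      unfolding real_sqrt_abs using t by simp
    moreover have "sqrt (2 * t * D) \<le> sqrt (2 * t * B)"
      using t B by (simp add: D_def mult_left_mono)
    ultimately have thr: "2 * t \<le> l * sqrt (2 * t * B)"
      using l0 by (metis mult_left_mono)
    have "real (card G) * exp (2 * t) = (\<Sum>A\<in>G. exp (2 * t))" by simp
    also have "\<dots> \<le> (\<Sum>A\<in>G. exp (l * signed_sum I A d))"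
    proof (intro sum_mono)
      fix A assume "A \<in> G"
      then have "l * sqrt (2 * t * B) \<le> l * signed_sum I A d"
        using l0 by (intro mult_left_mono) (auto simp: G_def)
      then show "exp (2 * t) \<le> exp (l * signed_sum I A d)" using thr by simp
    qed
    also have "\<dots> \<le> (\<Sum>A\<in>Pow I. exp (l * signed_sum I A d))"
      using I by (intro sum_mono2) (auto simp: G_def)
    also have "\<dots> \<le> 2 ^ card I * exp (l\<^sup>2 * D / 2)"
      unfolding D_def by (rule sum_exp_signed_sum_le[OF I])
    also have "\<dots> = 2 ^ card I * exp (- t) * exp (2 * t)"
      by (simp add: l2 flip: exp_add)
    finally show ?thesis unfolding G_def by simp
  qed
qed

section \<open>Sums of squared deviations\<close>

definition avg :: "nat \<Rightarrow> (nat \<Rightarrow> real) \<Rightarrow> real"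
  where "avg m v = (\<Sum>i<m. v i) / real m"

definition ssd :: "nat \<Rightarrow> (nat \<Rightarrow> real) \<Rightarrow> real"
  where "ssd m v = (\<Sum>i<m. (v i - avg m v)\<^sup>2)"

lemma ssd_nonneg: "ssd m v \<ge> 0"
  by (simp add: ssd_def sum_nonneg)

lemma sum_square_dev_eq:
  assumes "m > 0"
  shows "(\<Sum>i<m. (v i - c)\<^sup>2) = ssd m v + real m * (avg m v - c)\<^sup>2"
proof -
  have "(\<Sum>i<m. v i) = real m * avg m v"
    using assms by (simp add: avg_def)
  then show ?thesis
    by (simp add: ssd_def power2_diff sum.distrib sum_subtractf flip: sum_distrib_left sum_distrib_right)
       (simp add: power2_eq_square algebra_simps)
qed

lemma ssd_le: "ssd m v \<le> (\<Sum>i<m. (v i - c)\<^sup>2)"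
proof (cases "m = 0")
  case False
  then show ?thesis by (subst sum_square_dev_eq) auto
qed (simp add: ssd_def)

lemma avg_add: "avg m (\<lambda>i. v i + w i) = avg m v + avg m w"
  by (simp add: avg_def sum.distrib add_divide_distrib)

lemma abs_avg_diff_le:
  assumes "m > 0" "\<And>i. i < m \<Longrightarrow> \<bar>a i - b i\<bar> \<le> e"
  shows "\<bar>avg m a - avg m b\<bar> \<le> e"
proof -
  have "\<bar>\<Sum>i<m. a i - b i\<bar> \<le> (\<Sum>i<m. e)"
    using assms(2) by (intro order_trans[OF sum_abs] sum_mono) auto
  moreover have "avg m a - avg m b = (\<Sum>i<m. a i - b i) / real m"
    by (simp add: avg_def sum_subtractf diff_divide_distrib)
  ultimately show ?thesis
    using assms(1) by (simp add: abs_divide divide_le_eq mult.commute)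
qed

lemma avg_mem_unit:
  assumes "m > 0" "\<And>i. i < m \<Longrightarrow> v i \<in> {0..1}"
  shows "avg m v \<in> {0..1}"
proof -
  have "(\<Sum>i<m. v i) \<le> (\<Sum>i<m. 1)"
    using assms(2) by (intro sum_mono) auto
  moreover have "(\<Sum>i<m. v i) \<ge> 0"
    using assms(2) by (intro sum_nonneg) auto
  ultimately show ?thesis using assms(1) by (simp add: avg_def)
qed

text \<open>\<open>sqrt (ssd m v)\<close> is the Euclidean norm of the centred vector, hence a
  seminorm, and centring the perturbation does not increase its norm.\<close>

lemma sqrt_ssd_le:
  assumes ab: "\<And>i. i < m \<Longrightarrow> \<bar>a i - b i\<bar> \<le> e"
  shows "sqrt (ssd m a) \<le> sqrt (ssd m b) + sqrt (real m) * e"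
proof (cases "m = 0")
  case False
  define d where "d = (\<lambda>i. a i - b i)"
  have e: "e \<ge> 0" using ab[of 0] False by linarith
  have avg: "avg m a = avg m b + avg m d"
    using avg_add[of m b d] by (simp add: d_def)
  have "sqrt (ssd m a) = L2_set (\<lambda>i. (b i - avg m b) + (d i - avg m d)) {..<m}"
    unfolding ssd_def L2_set_def avg by (simp add: d_def algebra_simps)
  also have "\<dots> \<le> sqrt (ssd m b) + sqrt (ssd m d)"
    unfolding ssd_def L2_set_def[symmetric] by (rule L2_set_triangle_ineq)
  also have "ssd m d \<le> (\<Sum>i<m. (d i - 0)\<^sup>2)" by (rule ssd_le)
  also have "\<dots> \<le> (\<Sum>i<m. e\<^sup>2)"
    using ab e by (intro sum_mono) (auto simp: d_def abs_le_square_iff[symmetric])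
  finally show ?thesis using e by (simp add: real_sqrt_mult)
qed (simp add: ssd_def)

text \<open>Lagrange's identity \<open>*\<close>, by induction on the length, turns the sum over
  pairs into \<open>n\<close> times the sum of squared deviations.\<close>

lemma emp_var_eq_ssd:
  assumes "n \<ge> 2"
  shows "emp_var n f x = ssd n (\<lambda>i. f (x i)) / (real n - 1)"
proof -
  have *: "(\<Sum>j<m. \<Sum>i<j. (u i - u j)\<^sup>2) = real m * (\<Sum>i<m. (u i)\<^sup>2) - (\<Sum>i<m. u i)\<^sup>2"
    for m and u :: "nat \<Rightarrow> real"
  proof (induction m)
    case (Suc m)
    have "(\<Sum>i<m. (u i - u m)\<^sup>2) = (\<Sum>i<m. (u i)\<^sup>2) + real m * (u m)\<^sup>2 - 2 * u m * (\<Sum>i<m. u i)"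
      by (simp add: power2_diff sum.distrib sum_subtractf sum_distrib_left mult_ac)
    with Suc show ?case by (simp add: power2_sum algebra_simps)
  qed simp
  let ?u = "\<lambda>i. f (x i)"
  have "(\<Sum>i<n. ?u i) = real n * avg n ?u" using assms by (simp add: avg_def)
  moreover have "(\<Sum>i<n. (?u i)\<^sup>2) = ssd n ?u + real n * (avg n ?u)\<^sup>2"
    using sum_square_dev_eq[of n ?u 0] assms by simp
  ultimately have "(\<Sum>j<n. \<Sum>i<j. (?u i - ?u j)\<^sup>2) = real n * ssd n ?u"
    unfolding * by (simp add: power2_eq_square algebra_simps)
  then show ?thesis
    using assms by (simp add: emp_var_def)
qed

section \<open>Real inequalities behind the deviation bound\<close>

lemma le_of_quadratic:
  fixes x b :: real
  assumes "x\<^sup>2 \<le> b * x + c" "b * z + c \<le> z\<^sup>2" "b \<le> z" "0 \<le> z"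
  shows "x \<le> z"
proof (rule ccontr)
  assume "\<not> x \<le> z"
  then have "0 < (x - z) * (x + z - b)" using assms by (intro mult_pos_pos) auto
  then show False using assms by (simp add: power2_eq_square algebra_simps)
qed

text \<open>Here \<open>D\<close> is the gap of the two half means, and \<open>S\<close>,
  \<open>W\<close> are the squared deviations of the sample from the common mean and from its own.
  Hypothesis \<open>2\<close> yields \<open>sqrt T \<le> sqrt 2 * (sqrt t + sqrt S)\<close>; the
  term \<open>n * D^2 / 4\<close> of \<open>S\<close> is then removed according to the sign of
  \<open>D\<close>.\<close>

lemma deviation_bound:
  fixes D S T W t n :: real
  assumes S: "S = W + n * D\<^sup>2 / 4" and W: "W \<ge> 0" and T: "T \<ge> 0"
    and t: "0 < t" "t \<le> n" and D: "\<bar>D\<bar> \<le> 1"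
    and 1: "n * D \<le> 2 * sqrt (t * T)" and 2: "T \<le> 2 * S + sqrt (2 * t * T)"
  shows "n * D + sqrt (t * T) \<le> sqrt (18 * t * W) + 10 * t"
proof -
  define r q w y s where "r = sqrt t" "q = sqrt S" "w = sqrt W" "y = sqrt T" "s = sqrt (2::real)"
  note defs = this
  have S0: "S \<ge> 0" using S W t by simp
  have pos: "r > 0" "q \<ge> 0" "w \<ge> 0" "y \<ge> 0" "s > 0" using t S0 W T by (auto simp: defs)
  have sq: "r\<^sup>2 = t" "q\<^sup>2 = S" "w\<^sup>2 = W" "y\<^sup>2 = T" "s\<^sup>2 = 2" using t S0 W T by (auto simp: defs)
  have s: "7/5 < s" "s < 283/200"
    unfolding defs by (intro real_less_rsqrt real_less_lsqrt; simp add: power2_eq_square)+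
  have ry: "sqrt (t * T) = r * y" "sqrt (2 * t * T) = s * r * y"
    by (simp_all add: defs real_sqrt_mult)
  have s18: "sqrt (18 * t * W) = 3 * s * r * w"
    using real_sqrt_mult[of 9 2] by (simp add: defs real_sqrt_mult)
  have y: "y \<le> s * (r + q)"
  proof (rule le_of_quadratic)
    show "y\<^sup>2 \<le> (s * r) * y + 2 * q\<^sup>2" using 2 by (simp add: sq ry)
    have "0 \<le> s * r" "0 \<le> s * q" "0 \<le> r * q" using pos by auto
    then show "s * r \<le> s * (r + q)" "0 \<le> s * (r + q)" by (auto simp: algebra_simps)
    have "(s * (r + q))\<^sup>2 = s * r * (s * (r + q)) + s\<^sup>2 * (r * q) + s\<^sup>2 * q\<^sup>2"
      by (simp add: power2_eq_square algebra_simps)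
    then show "s * r * (s * (r + q)) + 2 * q\<^sup>2 \<le> (s * (r + q))\<^sup>2"
      using \<open>0 \<le> r * q\<close> unfolding sq(5) by simp
  qed
  show ?thesis
  proof (cases "D \<ge> 0")
    case True
    \<comment> \<open>As \<open>D\<close> is in the unit interval, hypothesis \<open>1\<close> also
      controls \<open>n * D^2\<close>, which closes a quadratic inequality for
      \<open>q\<close>.\<close>
    have "n * D\<^sup>2 \<le> n * D" using True D t by (simp add: power2_eq_square mult_left_le)
    also have "\<dots> \<le> 2 * (r * y)" using 1 ry by simp
    also have "\<dots> \<le> 2 * (r * (s * (r + q)))" using y pos by (intro mult_left_mono) auto
    also have "\<dots> = 2 * s * (r * (r + q))" by simp
    also have "\<dots> \<le> 283/100 * (r * (r + q))" using s pos by (intro mult_right_mono) auto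
    finally have "q\<^sup>2 \<le> (283/400 * r) * q + (w\<^sup>2 + 283/400 * r\<^sup>2)"
      unfolding sq(2) sq(3) S by (simp add: algebra_simps power2_eq_square)
    \<comment> \<open>\<open>127/100\<close> lies slightly above the positive root of
      \<open>x^2 = 283/400 * (x + 1)\<close>.\<close>
    then have q: "q \<le> w + 127/100 * r"
    proof (rule le_of_quadratic)
      have "(w + 127/100 * r)\<^sup>2 = 283/400 * r * (w + 127/100 * r) + (w\<^sup>2 + 283/400 * r\<^sup>2)
          + 733/400 * (w * r) + 11/1600 * r\<^sup>2"
        by (simp add: power2_eq_square field_simps)
      moreover have "0 \<le> r\<^sup>2" "0 \<le> w * r" using pos by auto
      ultimately show "283/400 * r * (w + 127/100 * r) + (w\<^sup>2 + 283/400 * r\<^sup>2) \<le> (w + 127/100 * r)\<^sup>2"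
        by linarith
      show "283/400 * r \<le> w + 127/100 * r" "0 \<le> w + 127/100 * r" using pos by auto
    qed
    \<comment> \<open>Origin of the constant 18: the \<open>3\<close> adds the \<open>2\<close> of
      hypothesis \<open>1\<close> to the extra \<open>sqrt (t * T)\<close>, and
      \<open>3 * sqrt 2 = sqrt 18\<close>.\<close>
    have "n * D + sqrt (t * T) \<le> 3 * (r * y)" using 1 ry by simp
    also have "\<dots> \<le> 3 * (r * (s * (r + (w + 127/100 * r))))"
      using order_trans[OF y] q pos by (intro mult_left_mono) auto
    also have "\<dots> = 3 * s * r * w + s * (681/100) * r\<^sup>2"
      by (simp add: algebra_simps power2_eq_square)
    also have "\<dots> \<le> 3 * s * r * w + 283/200 * (681/100) * r\<^sup>2"
      using s by (intro add_left_mono mult_right_mono) auto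
    also have "\<dots> \<le> sqrt (18 * t * W) + 10 * t" using t by (simp add: s18 sq)
    finally show ?thesis .
  next
    case False
    \<comment> \<open>Now \<open>n * D\<close> is negative and pays for the \<open>D\<close> term of
      \<open>q\<close>, because \<open>t \<le> n\<close> and \<open>sqrt 2 / 2 < 1\<close>.\<close>
    have "q \<le> w + sqrt n * \<bar>D\<bar> / 2"
      unfolding defs S using sqrt_add_le_add_sqrt[of W "n * D\<^sup>2 / 4"] W t
      by (simp add: real_sqrt_mult real_sqrt_divide)
    then have "y \<le> s * (r + w + sqrt n * \<bar>D\<bar> / 2)"
      using y pos by (smt (verit, best) mult_left_mono)
    then have "r * y \<le> r * (s * (r + w + sqrt n * \<bar>D\<bar> / 2))" using pos by (intro mult_left_mono) auto
    also have "\<dots> = s * r\<^sup>2 + s * r * w + (s / 2 * \<bar>D\<bar>) * (r * sqrt n)"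
      by (simp add: algebra_simps power2_eq_square)
    also have "r * sqrt n \<le> sqrt n * sqrt n"
      using t by (intro mult_right_mono) (auto simp: defs)
    also have "sqrt n * sqrt n = n" using t by simp
    finally have "r * y \<le> s * r\<^sup>2 + s * r * w + s / 2 * \<bar>D\<bar> * n"
      using pos by (simp add: mult_left_mono)
    moreover have "s / 2 * \<bar>D\<bar> * n \<le> 1 * \<bar>D\<bar> * n"
      using s t by (intro mult_right_mono) auto
    moreover have "s * r\<^sup>2 \<le> 10 * t" unfolding sq using s t by (intro mult_right_mono) auto
    moreover have "s * r * w \<ge> 0" using pos by simp
    moreover have "n * D = - (1 * \<bar>D\<bar> * n)" using False by simp
    ultimately show ?thesis unfolding s18 ry by linarith
  qed
qed

section \<open>Random swaps\<close>

text \<open>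
  A vector \<open>v\<close> on a double sample has the values at the sample in the coordinates \<open>i < n\<close> and those
  at the ghost sample in the coordinates \<open>n + i\<close>.
\<close>

definition gap :: "nat \<Rightarrow> (nat \<Rightarrow> real) \<Rightarrow> real"
  where "gap n v = avg n (\<lambda>i. v (n + i)) - avg n v"

text \<open>The bound \<open>k < 2 * n\<close> makes this an involution of all naturals for every
  \<open>A\<close>, not only for subsets of \<open>{..<n}\<close>.\<close>

definition swap :: "nat \<Rightarrow> nat set \<Rightarrow> nat \<Rightarrow> nat"
  where "swap n A k =
    (if k < n then if k \<in> A then n + k else k
     else if k < 2 * n \<and> k - n \<in> A then k - n else k)"

lemma swap_less: "k < 2 * n \<Longrightarrow> swap n A k < 2 * n"
  by (auto simp: swap_def)

lemma swap_swap: "swap n A (swap n A k) = k"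
  by (auto simp: swap_def)

lemma inj_swap: "inj (swap n A)"
  by (metis swap_swap injI)

lemma sum_swap: "(\<Sum>k<2 * n. g (swap n A k)) = (\<Sum>k<2 * n. g k)"
  by (rule sum.reindex_bij_witness[of _ "swap n A" "swap n A"]) (auto simp: swap_swap swap_less)

lemma ssd_swap: "ssd (2 * n) (\<lambda>k. v (swap n A k)) = ssd (2 * n) v"
proof -
  have avg: "avg (2 * n) (\<lambda>k. v (swap n A k)) = avg (2 * n) v"
    unfolding avg_def by (subst sum_swap) simp
  show ?thesis
    unfolding ssd_def avg by (rule sum_swap)
qed

lemma sum_double:
  fixes g :: "nat \<Rightarrow> 'b :: comm_monoid_add"
  shows "(\<Sum>k<2 * n. g k) = (\<Sum>i<n. g i) + (\<Sum>i<n. g (n + i))"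
proof -
  have "(\<Sum>k<n + m. g k) = (\<Sum>i<n. g i) + (\<Sum>i<m. g (n + i))" for m
    by (induction m) (auto simp: add.assoc)
  then show ?thesis by (simp add: mult_2)
qed

lemma avg_double: "avg (2 * n) v = avg n v + gap n v / 2"
  unfolding avg_def gap_def sum_double by (simp add: add_divide_distrib diff_divide_distrib)

text \<open>As \<open>ssd (2 * n) v\<close> is invariant under swaps, under a random swap both
  conditions compare a Rademacher sum with a fixed threshold.\<close>

definition balanced :: "nat \<Rightarrow> real \<Rightarrow> (nat \<Rightarrow> real) \<Rightarrow> bool"
  where "balanced n t v \<longleftrightarrow>
    real n * gap n v \<le> 2 * sqrt (t * ssd (2 * n) v) \<and>
    ssd (2 * n) v \<le> 2 * (\<Sum>i<n. (v i - avg (2 * n) v)\<^sup>2) + sqrt (2 * t * ssd (2 * n) v)"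

lemma card_not_balanced_le:
  assumes n: "n > 0" and t: "t \<ge> 0" and a: "\<And>k. k < 2 * n \<Longrightarrow> a k \<in> {0..1}"
  shows "real (card {A\<in>Pow {..<n}. \<not> balanced n t (\<lambda>k. a (swap n A k))}) \<le> 2 * (2 ^ n * exp (- t))"
proof -
  define c where "c = avg (2 * n) a"
  define T where "T = ssd (2 * n) a"
  define d where "d = (\<lambda>i. a (n + i) - a i)"
  define e where "e = (\<lambda>i. (a (n + i) - c)\<^sup>2 - (a i - c)\<^sup>2)"
  have T: "T = (\<Sum>i<n. (a i - c)\<^sup>2 + (a (n + i) - c)\<^sup>2)"
    by (simp add: T_def c_def ssd_def sum_double sum.distrib)
  have c01: "c \<in> {0..1}" unfolding c_def using n a by (intro avg_mem_unit) auto
  let ?v = "\<lambda>A k. a (swap n A k)"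
  have gap: "real n * gap n (?v A) = signed_sum {..<n} A d" for A
    using n
    by (auto simp: gap_def avg_def signed_sum_def d_def swap_def right_diff_distrib
        intro!: sum.cong simp flip: sum_subtractf)
  have avg: "avg (2 * n) (?v A) = c" for A
    unfolding avg_def c_def by (subst sum_swap) simp
  \<comment> \<open>The two halves add up to \<open>T\<close>, so this is the ghost half minus the
    sample half.\<close>
  have S: "T - 2 * (\<Sum>i<n. (?v A i - c)\<^sup>2) = signed_sum {..<n} A e" for A
    unfolding T signed_sum_def e_def sum_distrib_left sum_subtractf[symmetric]
    by (intro sum.cong) (auto simp: swap_def)
  have "(d i)\<^sup>2 \<le> 2 * ((a i - c)\<^sup>2 + (a (n + i) - c)\<^sup>2)" for i
    using zero_le_power2[of "(a i - c) + (a (n + i) - c)"]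
    by (simp add: d_def power2_eq_square algebra_simps)
  then have "(\<Sum>i<n. (d i)\<^sup>2) \<le> 2 * T"
    unfolding T sum_distrib_left by (intro sum_mono) auto
  from card_signed_sum_gt_le[OF _ t this]
  have 1: "real (card {A\<in>Pow {..<n}. signed_sum {..<n} A d > sqrt (2 * t * (2 * T))}) \<le> 2 ^ n * exp (- t)"
    by simp
  \<comment> \<open>For squared deviations \<open>p\<close>, \<open>q\<close> in the unit interval,
    \<open>(q - p)^2 \<le> p^2 + q^2 \<le> p + q\<close>.\<close>
  have "(e i)\<^sup>2 \<le> (a i - c)\<^sup>2 + (a (n + i) - c)\<^sup>2" if "i < n" for i
  proof -
    have sq: "0 \<le> p\<^sup>2 \<and> p\<^sup>2 \<le> 1" if "\<bar>p\<bar> \<le> 1" for p :: real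
      using that by (simp add: abs_square_le_1)
    define p q where "p = (a i - c)\<^sup>2" "q = (a (n + i) - c)\<^sup>2"
    have "0 \<le> p" "p \<le> 1" "0 \<le> q" "q \<le> 1"
      using sq[of "a i - c"] sq[of "a (n + i) - c"] a[of i] a[of "n + i"] c01 that
      by (auto simp: p_q_def)
    then have "p * p \<le> p" "q * q \<le> q" "0 \<le> p * q" by (auto simp: mult_left_le)
    then have "(q - p)\<^sup>2 \<le> p + q" by (simp add: power2_eq_square algebra_simps)
    then show ?thesis by (simp add: e_def p_q_def)
  qed
  then have "(\<Sum>i<n. (e i)\<^sup>2) \<le> T" unfolding T by (intro sum_mono) auto
  from card_signed_sum_gt_le[OF _ t this]
  have 2: "real (card {A\<in>Pow {..<n}. signed_sum {..<n} A e > sqrt (2 * t * T)}) \<le> 2 ^ n * exp (- t)"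
    by simp
  have s4: "sqrt (2 * t * (2 * T)) = 2 * sqrt (t * T)"
    using real_sqrt_mult[of 4 "t * T"] by (simp add: mult_ac)
  have "{A\<in>Pow {..<n}. \<not> balanced n t (?v A)} \<subseteq>
      {A\<in>Pow {..<n}. signed_sum {..<n} A d > sqrt (2 * t * (2 * T))} \<union>
      {A\<in>Pow {..<n}. signed_sum {..<n} A e > sqrt (2 * t * T)}"
    unfolding balanced_def ssd_swap gap avg T_def[symmetric] s4 S[symmetric] by auto
  then have "card {A\<in>Pow {..<n}. \<not> balanced n t (?v A)} \<le>
      card ({A\<in>Pow {..<n}. signed_sum {..<n} A d > sqrt (2 * t * (2 * T))} \<union>
      {A\<in>Pow {..<n}. signed_sum {..<n} A e > sqrt (2 * t * T)})"
    by (rule card_mono[rotated]) simp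
  also have "\<dots> \<le> card {A\<in>Pow {..<n}. signed_sum {..<n} A d > sqrt (2 * t * (2 * T))} +
      card {A\<in>Pow {..<n}. signed_sum {..<n} A e > sqrt (2 * t * T)}"
    by (rule card_Un_le)
  finally show ?thesis using 1 2 by linarith
qed

text \<open>A violation of the bound multiplied by \<open>n\<close>, the ghost mean replacing the
  expectation at the price found in \<open>mean_le_of_ghost\<close>. Only the values at the double
  sample remain, so a cover can be used.\<close>

definition exceeds :: "nat \<Rightarrow> real \<Rightarrow> (nat \<Rightarrow> real) \<Rightarrow> bool"
  where "exceeds n t v \<longleftrightarrow>
    sqrt (18 * t * ssd n v) + 15 * t < real n * gap n v + sqrt (t * ssd (2 * n) v) + 16 / 5"

text \<open>\<open>deviation_bound\<close> leaves \<open>a\<close> a remainder of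
  \<open>10 * t\<close>. At distance \<open>1 / n\<close>, passing from \<open>a\<close> to
  \<open>v\<close> costs only a constant and a multiple of \<open>sqrt t\<close>.\<close>

lemma balanced_not_exceeds:
  assumes n: "n \<ge> 16" and t: "9 / 4 \<le> t" "t \<le> real n"
    and a: "\<And>k. k < 2 * n \<Longrightarrow> a k \<in> {0..1}"
    and va: "\<And>k. k < 2 * n \<Longrightarrow> \<bar>a k - v k\<bar> \<le> 1 / real n"
    and bal: "balanced n t a"
  shows "\<not> exceeds n t v"
proof -
  define c where "c = avg (2 * n) a"
  have "avg n a \<in> {0..1}" "avg n (\<lambda>i. a (n + i)) \<in> {0..1}"
    using n a by (auto intro!: avg_mem_unit simp del: atLeastAtMost_iff)
  then have gap1: "\<bar>gap n a\<bar> \<le> 1" by (auto simp: gap_def)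
  have "(\<Sum>i<n. (a i - c)\<^sup>2) = ssd n a + real n * (avg n a - c)\<^sup>2"
    using n by (intro sum_square_dev_eq) auto
  then have S: "(\<Sum>i<n. (a i - c)\<^sup>2) = ssd n a + real n * (gap n a)\<^sup>2 / 4"
    by (simp add: c_def avg_double power_divide)
  have a_bound: "real n * gap n a + sqrt (t * ssd (2 * n) a) \<le> sqrt (18 * t * ssd n a) + 10 * t"
    using bal t gap1 unfolding balanced_def c_def[symmetric]
    by (intro deviation_bound[OF S]) (auto simp: ssd_nonneg)
  have "\<bar>avg n v - avg n a\<bar> \<le> 1 / real n"
       "\<bar>avg n (\<lambda>i. v (n + i)) - avg n (\<lambda>i. a (n + i))\<bar> \<le> 1 / real n"
    using n va by (auto intro!: abs_avg_diff_le simp: abs_minus_commute)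
  then have "gap n v \<le> gap n a + 2 / real n" by (simp add: gap_def)
  then have gap: "real n * gap n v \<le> real n * gap n a + 2"
    using n by (simp add: field_simps)
  have T: "sqrt (ssd (2 * n) v) \<le> sqrt (ssd (2 * n) a) + sqrt (real (2 * n)) * (1 / real n)"
    using va by (intro sqrt_ssd_le) (auto simp: abs_minus_commute)
  have W: "sqrt (ssd n a) \<le> sqrt (ssd n v) + sqrt (real n) * (1 / real n)"
    using va by (intro sqrt_ssd_le) auto
  define r where "r = sqrt t"
  have "r \<ge> 3 / 2"
    unfolding r_def by (rule real_le_rsqrt) (use t in \<open>simp add: power_divide\<close>)
  moreover have "r\<^sup>2 = t" using t by (simp add: r_def)
  ultimately have r: "r \<ge> 3 / 2" "r\<^sup>2 = t" .
  have nn: "sqrt (real n) * (1 / real n) \<le> 1 / 4"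
  proof -
    have "sqrt (real n) * (1 / real n) = 1 / sqrt (real n)"
      using n by (simp add: divide_simps)
    also have "\<dots> \<le> 1 / 4"
      using n by (intro divide_left_mono) (auto intro!: real_le_rsqrt)
    finally show ?thesis .
  qed
  have s2: "sqrt 2 \<le> (3/2 :: real)" by (intro real_le_lsqrt) (auto simp: power2_eq_square)
  have "sqrt (real (2 * n)) * (1 / real n) = sqrt 2 * (sqrt (real n) * (1 / real n))"
    by (simp add: real_sqrt_mult)
  also have "\<dots> \<le> 3/2 * (1/4)" using s2 nn by (intro mult_mono) auto
  finally have T': "sqrt (ssd (2 * n) v) \<le> sqrt (ssd (2 * n) a) + 3/8" using T by linarith
  have W': "sqrt (ssd n a) \<le> sqrt (ssd n v) + 1/4" using W nn by linarith
  have rT: "sqrt (t * ssd (2 * n) v) \<le> sqrt (t * ssd (2 * n) a) + 3/8 * r"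
    using mult_left_mono[OF T', of r] r by (simp add: r_def real_sqrt_mult algebra_simps)
  have "sqrt (18::real) \<le> 9/2" by (intro real_le_lsqrt) (auto simp: power2_eq_square)
  then have "sqrt 18 * r * (1/4) \<le> 9/8 * r" using r by simp
  then have rW: "sqrt (18 * t * ssd n a) \<le> sqrt (18 * t * ssd n v) + 9/8 * r"
    using mult_left_mono[OF W', of "sqrt 18 * r"] r by (simp add: r_def real_sqrt_mult algebra_simps)
  \<comment> \<open>The budget: \<open>3/8 * r + 9/8 * r\<close> is at most \<open>t\<close>, and
    \<open>2 + 16/5\<close> is below \<open>4 * t\<close>; with \<open>10 * t\<close> this stays
    under \<open>15 * t\<close>.\<close>
  have "3/2 * r \<le> t" using r by (simp add: power2_eq_square flip: r(2))
  then show ?thesis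
    unfolding exceeds_def using rT rW gap a_bound t by linarith
qed

text \<open>Swapping permutes the coordinates of \<open>a\<close> and \<open>v\<close> alike and
  keeps them close, so one cover serves all swaps and a union bound over \<open>C\<close>
  suffices.\<close>

lemma card_exceeds_le:
  assumes n: "n \<ge> 16" and t: "9 / 4 \<le> t" "t \<le> real n"
    and C: "finite C" "\<And>a k. a \<in> C \<Longrightarrow> k < 2 * n \<Longrightarrow> a k \<in> {0..1}"
    and V: "\<And>v. v \<in> V \<Longrightarrow> \<exists>a\<in>C. \<forall>k<2 * n. \<bar>a k - v k\<bar> \<le> 1 / real n"
  shows "real (card {A\<in>Pow {..<n}. \<exists>v\<in>V. exceeds n t (\<lambda>k. v (swap n A k))})
    \<le> real (card C) * (2 * (2 ^ n * exp (- t)))"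
proof -
  let ?N = "\<lambda>a. {A\<in>Pow {..<n}. \<not> balanced n t (\<lambda>k. a (swap n A k))}"
  have "{A\<in>Pow {..<n}. \<exists>v\<in>V. exceeds n t (\<lambda>k. v (swap n A k))} \<subseteq> (\<Union>a\<in>C. ?N a)"
  proof clarify
    fix A v assume A: "A \<subseteq> {..<n}" and v: "v \<in> V" and ex: "exceeds n t (\<lambda>k. v (swap n A k))"
    obtain a where a: "a \<in> C" and va: "\<And>k. k < 2 * n \<Longrightarrow> \<bar>a k - v k\<bar> \<le> 1 / real n"
      using V[OF v] by blast
    have "\<not> balanced n t (\<lambda>k. a (swap n A k))"
    proof
      assume b: "balanced n t (\<lambda>k. a (swap n A k))"
      have "\<not> exceeds n t (\<lambda>k. v (swap n A k))"
        by (rule balanced_not_exceeds[OF n t _ _ b]) (auto intro!: C(2)[OF a] va swap_less simp del: atLeastAtMost_iff)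
      with ex show False by contradiction
    qed
    then show "A \<in> (\<Union>a\<in>C. ?N a)" using a A by auto
  qed
  then have "card {A\<in>Pow {..<n}. \<exists>v\<in>V. exceeds n t (\<lambda>k. v (swap n A k))} \<le> card (\<Union>a\<in>C. ?N a)"
    by (rule card_mono[rotated]) (use C in auto)
  also have "\<dots> \<le> (\<Sum>a\<in>C. card (?N a))" by (rule card_UN_le[OF C(1)])
  finally have "real (card {A\<in>Pow {..<n}. \<exists>v\<in>V. exceeds n t (\<lambda>k. v (swap n A k))})
      \<le> (\<Sum>a\<in>C. real (card (?N a)))" by (simp flip: of_nat_sum)
  also have "\<dots> \<le> (\<Sum>a\<in>C. 2 * (2 ^ n * exp (- t)))"
    using n t C by (intro sum_mono card_not_balanced_le) auto
  finally show ?thesis by simp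
qed

section \<open>The ghost sample\<close>

text \<open>Chebyshev's inequality, including \<open>b = 0\<close>: there \<open>X\<close> is almost
  surely constant and the strict inequality makes the event null.\<close>

lemma (in prob_space) prob_deviation_gt_le:
  assumes [measurable]: "random_variable borel X" and int: "integrable M (\<lambda>x. (X x)\<^sup>2)"
    and var: "variance X \<le> b\<^sup>2" and b: "b \<ge> 0" and c: "c > 0"
  shows "prob {x \<in> space M. c * b < \<bar>X x - expectation X\<bar>} \<le> 1 / c\<^sup>2"
proof (cases "b = 0")
  case True
  have int': "integrable M X"
    using int by (rule square_integrable_imp_integrable[rotated]) measurable
  have "integrable M (\<lambda>x. (X x - expectation X)\<^sup>2)"
    using int int' by (simp add: power2_diff)
  moreover have "variance X = 0"
    using var True variance_positive[of X] by simp
  ultimately have "AE x in M. (X x - expectation X)\<^sup>2 = 0"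
    by (subst (asm) integral_nonneg_eq_0_iff_AE) auto
  then have "prob {x \<in> space M. c * b < \<bar>X x - expectation X\<bar>} = 0"
    using True by (subst prob_eq_0) auto
  then show ?thesis using c by simp
next
  case False
  then have cb: "c * b > 0" using b c by simp
  have "prob {x \<in> space M. c * b < \<bar>X x - expectation X\<bar>} \<le>
      prob {x \<in> space M. c * b \<le> \<bar>X x - expectation X\<bar>}"
    by (intro finite_measure_mono) auto
  also have "\<dots> \<le> variance X / (c * b)\<^sup>2"
    using cb int by (intro Chebyshev_inequality) auto
  also have "\<dots> \<le> b\<^sup>2 / (c * b)\<^sup>2"
    using var by (intro divide_right_mono) auto
  also have "\<dots> = 1 / c\<^sup>2" using False by (simp add: power_mult_distrib)
  finally show ?thesis .
qed

lemma integral_PiM_mult: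
  fixes g :: "'a \<Rightarrow> real"
  assumes M: "prob_space M" and J: "finite J" "i \<in> J" "j \<in> J"
    and g: "g \<in> borel_measurable M" and b: "\<And>z. z \<in> space M \<Longrightarrow> \<bar>g z\<bar> \<le> b"
    and 0: "(\<integral>z. g z \<partial>M) = 0"
  shows "(\<integral>x. g (x i) * g (x j) \<partial>PiM J (\<lambda>_. M)) = (if i = j then \<integral>z. (g z)\<^sup>2 \<partial>M else 0)"
proof -
  interpret M: prob_space M by (rule M)
  interpret product_prob_space "\<lambda>_. M" by standard
  \<comment> \<open>With factor \<open>1\<close> in all other coordinates, the integrand is a
    product over all of \<open>J\<close> and can be integrated factor by factor;
    \<open>k = i = j\<close> gives the square.\<close>
  let ?h = "\<lambda>k y. (if k = i then g y else 1) * (if k = j then g y else 1)"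
  have int: "integrable M (?h k)" for k
  proof (rule M.integrable_const_bound)
    have "\<bar>?h k z\<bar> \<le> (1 + b) * (1 + b)" if "z \<in> space M" for z
      unfolding abs_mult using b[OF that] by (intro mult_mono) auto
    then show "AE z in M. norm (?h k z) \<le> (1 + b) * (1 + b)" by auto
    show "?h k \<in> borel_measurable M" using g by auto
  qed
  have "g (x i) * g (x j) = (\<Prod>k\<in>J. ?h k (x k))" for x
    using J by (simp add: prod.distrib)
  then have "(\<integral>x. g (x i) * g (x j) \<partial>PiM J (\<lambda>_. M)) = (\<Prod>k\<in>J. \<integral>z. ?h k z \<partial>M)"
    using product_integral_prod[OF J(1), of ?h] int by simp
  also have "\<dots> = (if i = j then \<integral>z. (g z)\<^sup>2 \<partial>M else 0)"
  proof (cases "i = j")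
    case True
    then have "(\<integral>z. ?h k z \<partial>M) = (if k = i then \<integral>z. (g z)\<^sup>2 \<partial>M else 1)" for k
      by (simp add: power2_eq_square M.prob_space)
    then show ?thesis using J True by simp
  next
    case False
    then have "(\<integral>z. ?h i z \<partial>M) = 0" using 0 by simp
    then have "(\<Prod>k\<in>J. \<integral>z. ?h k z \<partial>M) = 0" by (intro prod_zero J(1) bexI[OF _ J(2)])
    then show ?thesis using False by simp
  qed
  finally show ?thesis .
qed

text \<open>By independence the variance of the sum is \<open>card J\<close> times that of one term,
  which is at most its second moment. Bounding the latter suits \<open>h = (f - P)^2\<close>, whose
  mean need not vanish.\<close>

lemma prob_sum_deviation_gt_le:
  fixes h :: "'a \<Rightarrow> real"
  assumes M: "prob_space M" and J: "finite J"
    and h[measurable]: "h \<in> borel_measurable M" and h1: "\<And>z. z \<in> space M \<Longrightarrow> \<bar>h z\<bar> \<le> 1"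
    and var: "real (card J) * (\<integral>z. (h z)\<^sup>2 \<partial>M) \<le> b\<^sup>2" and b: "b \<ge> 0" and c: "c > 0"
  shows "measure (PiM J (\<lambda>_. M)) {x \<in> space (PiM J (\<lambda>_. M)).
      c * b < \<bar>(\<Sum>i\<in>J. h (x i)) - real (card J) * (\<integral>z. h z \<partial>M)\<bar>} \<le> 1 / c\<^sup>2"
proof -
  interpret M: prob_space M by (rule M)
  let ?P = "PiM J (\<lambda>_. M)"
  interpret P: prob_space ?P by (intro prob_space_PiM M)
  define m where "m = (\<integral>z. h z \<partial>M)"
  have int: "integrable M h"
    by (rule M.integrable_const_bound[where B=1]) (use h1 in auto)
  have int2: "integrable M (\<lambda>z. (h z)\<^sup>2)"
    by (rule M.integrable_const_bound[where B=1]) (use h1 in \<open>auto simp: abs_square_le_1\<close>)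
  have m1: "\<bar>m\<bar> \<le> 1"
  proof -
    have "\<bar>m\<bar> \<le> (\<integral>z. \<bar>h z\<bar> \<partial>M)" unfolding m_def by (rule integral_abs_bound)
    also have "\<dots> \<le> (\<integral>z. 1 \<partial>M)" using int h1 by (intro integral_mono) auto
    finally show ?thesis by (simp add: M.prob_space)
  qed
  define g where "g z = h z - m" for z
  have [measurable]: "g \<in> borel_measurable M" by (simp add: g_def[abs_def])
  have g2: "\<bar>g z\<bar> \<le> 2" if "z \<in> space M" for z
    using h1[OF that] m1 by (auto simp: g_def)
  have g0: "(\<integral>z. g z \<partial>M) = 0" using int by (simp add: g_def m_def M.prob_space)
  have gvar: "(\<integral>z. (g z)\<^sup>2 \<partial>M) \<le> (\<integral>z. (h z)\<^sup>2 \<partial>M)"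
    using M.variance_eq[OF int int2] by (simp add: g_def m_def)
  have comp[measurable]: "(\<lambda>x. x i) \<in> measurable ?P M" if "i \<in> J" for i
    using that by (rule measurable_component_singleton)
  have xM: "x i \<in> space M" if "x \<in> space ?P" "i \<in> J" for x i
    using that by (auto simp: space_PiM)
  have intg: "integrable ?P (\<lambda>x. g (x i) * g (x j))" if "i \<in> J" "j \<in> J" for i j
  proof (rule P.integrable_const_bound)
    show "AE x in ?P. norm (g (x i) * g (x j)) \<le> 2 * 2"
    proof (intro AE_I2)
      fix x assume "x \<in> space ?P"
      then show "norm (g (x i) * g (x j)) \<le> 2 * 2"
        unfolding norm_mult using g2[OF xM] that by (intro mult_mono) auto
    qed
  qed (use that in measurable)
  have intg1: "integrable ?P (\<lambda>x. h (x i))" if "i \<in> J" for i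
    by (rule P.integrable_const_bound[where B=1]) (use that h1 xM in auto)
  have exp: "(\<integral>x. h (x i) \<partial>?P) = m" if i: "i \<in> J" for i
  proof -
    have "m = integral\<^sup>L (distr ?P M (\<lambda>x. x i)) h"
      using M i by (subst distr_PiM_component) (auto simp: m_def)
    also have "\<dots> = (\<integral>x. h (x i) \<partial>?P)" using i by (subst integral_distr) auto
    finally show ?thesis by simp
  qed
  let ?X = "\<lambda>x. \<Sum>i\<in>J. h (x i)"
  have EX: "P.expectation ?X = real (card J) * m"
    using intg1 exp by simp
  have X: "?X x - real (card J) * m = (\<Sum>i\<in>J. g (x i))" for x
    by (simp add: g_def sum_subtractf)
  have "P.variance ?X = (\<integral>x. (\<Sum>i\<in>J. \<Sum>j\<in>J. g (x i) * g (x j)) \<partial>?P)"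
    by (simp add: EX X power2_eq_square sum_product)
  also have "\<dots> = (\<Sum>i\<in>J. \<Sum>j\<in>J. if i = j then \<integral>z. (g z)\<^sup>2 \<partial>M else 0)"
    using intg by (simp add: integral_PiM_mult[OF M J _ _ _ g2 g0] cong: sum.cong)
  also have "\<dots> = real (card J) * (\<integral>z. (g z)\<^sup>2 \<partial>M)" using J by simp
  also have "\<dots> \<le> b\<^sup>2"
    using var gvar by (meson mult_left_mono of_nat_0_le_iff order_trans)
  finally have var: "P.variance ?X \<le> b\<^sup>2" .
  have "integrable ?P (\<lambda>x. (?X x)\<^sup>2)"
  proof (rule P.integrable_const_bound)
    show "AE x in ?P. norm ((?X x)\<^sup>2) \<le> (real (card J))\<^sup>2"
    proof (intro AE_I2)
      fix x assume x: "x \<in> space ?P"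
      have "\<bar>?X x\<bar> \<le> (\<Sum>i\<in>J. 1)"
        using h1[OF xM[OF x]] by (intro order_trans[OF sum_abs] sum_mono) auto
      then have "\<bar>?X x\<bar>\<^sup>2 \<le> (real (card J))\<^sup>2" by (intro power_mono) auto
      then show "norm ((?X x)\<^sup>2) \<le> (real (card J))\<^sup>2" by simp
    qed
  qed measurable
  from P.prob_deviation_gt_le[OF _ this var b c] show ?thesis
    unfolding EX m_def by simp
qed

text \<open>Chebyshev for both sums, \<open>s\<close> being the standard deviation of the first. As
  \<open>\<bar>f z - P\<bar> \<le> 1\<close>, the fourth moment is at most the second, so the same
  \<open>s\<close> serves for the squares.\<close>

lemma ghost_sample_prob_ge:
  fixes f :: "'a \<Rightarrow> real"
  assumes M: "prob_space M" and J: "finite J"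
    and f[measurable]: "f \<in> borel_measurable M" and f01: "\<And>z. z \<in> space M \<Longrightarrow> f z \<in> {0..1}"
  defines "P \<equiv> true_mean f M"
  defines "s \<equiv> sqrt (real (card J) * (\<integral>z. (f z - P)\<^sup>2 \<partial>M))"
  shows "measure (PiM J (\<lambda>_. M)) {x \<in> space (PiM J (\<lambda>_. M)).
      \<bar>\<Sum>i\<in>J. f (x i) - P\<bar> \<le> 7/5 * s \<and> s\<^sup>2 - 2 * s \<le> (\<Sum>i\<in>J. (f (x i) - P)\<^sup>2)} \<ge> 1/5"
proof -
  interpret M: prob_space M by (rule M)
  let ?P = "PiM J (\<lambda>_. M)"
  interpret P: prob_space ?P by (intro prob_space_PiM M)
  have intf: "integrable M f"
    by (rule M.integrable_const_bound[where B=1]) (use f01 in auto)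
  have "P \<le> (\<integral>z. 1 \<partial>M)" unfolding P_def using intf f01 by (intro integral_mono) auto
  moreover have "P \<ge> 0" unfolding P_def using f01 by (intro integral_nonneg_AE AE_I2) auto
  ultimately have P01: "0 \<le> P" "P \<le> 1" by (auto simp: M.prob_space)
  have h1: "\<bar>f z - P\<bar> \<le> 1" if "z \<in> space M" for z
    using f01[OF that] P01 by auto
  then have sq1: "(f z - P)\<^sup>2 \<le> 1" if "z \<in> space M" for z
    using that by (simp add: abs_square_le_1)
  have h0: "(\<integral>z. f z - P \<partial>M) = 0" using intf by (simp add: P_def M.prob_space)
  have int2: "integrable M (\<lambda>z. (f z - P)\<^sup>2)"
    by (rule M.integrable_const_bound[where B=1]) (use sq1 in auto)
  have s2: "s\<^sup>2 = real (card J) * (\<integral>z. (f z - P)\<^sup>2 \<partial>M)" and s0: "s \<ge> 0"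
    by (auto simp: s_def)
  have "(\<integral>z. ((f z - P)\<^sup>2)\<^sup>2 \<partial>M) \<le> (\<integral>z. (f z - P)\<^sup>2 \<partial>M)"
  proof (rule integral_mono[OF _ int2])
    have q: "0 \<le> ((f z - P)\<^sup>2)\<^sup>2 \<and> ((f z - P)\<^sup>2)\<^sup>2 \<le> (f z - P)\<^sup>2" if "z \<in> space M" for z
      using mult_left_le[OF sq1[OF that], of "(f z - P)\<^sup>2"]
      by (simp only: power2_eq_square[of "(f z - P)\<^sup>2"]) simp
    then show "((f z - P)\<^sup>2)\<^sup>2 \<le> (f z - P)\<^sup>2" if "z \<in> space M" for z
      using that by blast
    show "integrable M (\<lambda>z. ((f z - P)\<^sup>2)\<^sup>2)"
      by (rule M.integrable_const_bound[where B=1]) (use q sq1 order_trans in \<open>auto intro!: AE_I2\<close>, fastforce)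
  qed
  then have s4: "real (card J) * (\<integral>z. ((f z - P)\<^sup>2)\<^sup>2 \<partial>M) \<le> s\<^sup>2"
    unfolding s2 by (intro mult_left_mono) auto
  have comp[measurable]: "(\<lambda>x. x i) \<in> measurable ?P M" if "i \<in> J" for i
    using that by (rule measurable_component_singleton)
  let ?B1 = "{x \<in> space ?P. 7/5 * s < \<bar>\<Sum>i\<in>J. f (x i) - P\<bar>}"
  let ?B2 = "{x \<in> space ?P. 2 * s < \<bar>(\<Sum>i\<in>J. (f (x i) - P)\<^sup>2) - s\<^sup>2\<bar>}"
  let ?G = "{x \<in> space ?P. \<bar>\<Sum>i\<in>J. f (x i) - P\<bar> \<le> 7/5 * s \<and> s\<^sup>2 - 2 * s \<le> (\<Sum>i\<in>J. (f (x i) - P)\<^sup>2)}"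
  have "P.prob ?B1 \<le> 1 / (7/5)\<^sup>2"
    using prob_sum_deviation_gt_le[where h = "\<lambda>z. f z - P" and c = "7/5", OF M J _ h1 _ s0] by (simp add: h0 s2)
  then have B1: "P.prob ?B1 \<le> 25/49" by (simp add: power2_eq_square)
  have "P.prob ?B2 \<le> 1 / 2\<^sup>2"
    using prob_sum_deviation_gt_le[where h = "\<lambda>z. (f z - P)\<^sup>2" and c = 2, OF M J _ _ s4 s0] sq1 by (simp add: s2)
  then have B2: "P.prob ?B2 \<le> 1/4" by (simp add: power2_eq_square)
  have [measurable]: "?B1 \<in> sets ?P" "?B2 \<in> sets ?P" "?G \<in> sets ?P" by measurable
  have "1 = P.prob (space ?P)" by (simp add: P.prob_space)
  also have "\<dots> \<le> P.prob (?G \<union> (?B1 \<union> ?B2))"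
    by (intro P.finite_measure_mono) auto
  also have "\<dots> \<le> P.prob ?G + (P.prob ?B1 + P.prob ?B2)"
    by (intro order_trans[OF measure_Un_le] add_left_mono measure_Un_le) auto
  \<comment> \<open>\<open>25/49 + 1/4 < 4/5\<close>.\<close>
  finally show ?thesis using B1 B2 by linarith
qed

text \<open>This eliminates the unknown \<open>s\<close>: the ghost half of \<open>T\<close> is at
  least the sum of squares about \<open>P\<close> minus \<open>Y^2 / n\<close>, and \<open>2\<close>
  turns this into a quadratic inequality for \<open>s\<close>.\<close>

lemma mean_le_of_ghost:
  assumes n: "n \<ge> 16" and t: "t \<ge> 9/4" and s: "s \<ge> 0"
    and 1: "\<bar>\<Sum>i<n. v (n + i) - P\<bar> \<le> 7/5 * s"
    and 2: "s\<^sup>2 - 2 * s \<le> (\<Sum>i<n. (v (n + i) - P)\<^sup>2)"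
  shows "real n * P \<le> (\<Sum>i<n. v (n + i)) + sqrt (t * ssd (2 * n) v) + 16/5"
proof -
  define T where "T = ssd (2 * n) v"
  define Y where "Y = (\<Sum>i<n. v (n + i) - P)"
  define W where "W = ssd n (\<lambda>i. v (n + i))"
  have T0: "T \<ge> 0" by (simp add: T_def ssd_nonneg)
  have "W \<le> (\<Sum>i<n. (v (n + i) - avg (2 * n) v)\<^sup>2)" unfolding W_def by (rule ssd_le)
  also have "\<dots> \<le> T"
    unfolding T_def ssd_def sum_double by (simp add: sum_nonneg)
  finally have WT: "W \<le> T" .
  have Y: "avg n (\<lambda>i. v (n + i)) - P = Y / real n"
    using n by (simp add: avg_def Y_def sum_subtractf diff_divide_distrib)
  have "(\<Sum>i<n. (v (n + i) - P)\<^sup>2) = W + real n * (Y / real n)\<^sup>2"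
    unfolding W_def Y[symmetric] using n by (intro sum_square_dev_eq) auto
  also have "real n * (Y / real n)\<^sup>2 = Y\<^sup>2 / real n"
    using n by (simp add: power2_eq_square)
  also have "\<dots> \<le> Y\<^sup>2 / 16" using n by (intro divide_left_mono) auto
  also have "Y\<^sup>2 \<le> (7/5 * s)\<^sup>2"
    using 1 by (simp add: Y_def flip: abs_le_square_iff) 
  also have "(7/5 * s)\<^sup>2 = 49/25 * s\<^sup>2" by (simp add: power_mult_distrib power_divide)
  \<comment> \<open>\<open>49/25 / 16 \<le> 1/8\<close>, the \<open>16\<close> coming from
    \<open>n \<ge> 16\<close>.\<close>
  finally have "s\<^sup>2 - 2 * s \<le> T + s\<^sup>2 / 8"
    using 2 WT zero_le_power2[of s] by linarith
  then have quad: "s\<^sup>2 \<le> 16/7 * s + 8/7 * T" by simp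
  \<comment> \<open>Multiplied by \<open>7/5\<close>, these coefficients become \<open>1\<close> and
    \<open>16/5\<close>. The bound \<open>t \<ge> 9/4\<close> is just enough, since
    \<open>25/49 * 9/4 \<ge> 8/7\<close>.\<close>
  have "s \<le> 5/7 * sqrt (t * T) + 16/7"
  proof (rule le_of_quadratic[OF quad])
    define q where "q = sqrt (t * T)"
    have q0: "q \<ge> 0" using t T0 by (simp add: q_def)
    have "9/4 * T \<le> t * T" using t T0 by (intro mult_right_mono) auto
    also have "t * T = q\<^sup>2" using t T0 by (simp add: q_def)
    finally have q2: "9/4 * T \<le> q\<^sup>2" .
    have e: "(5/7 * q + 16/7)\<^sup>2 = 25/49 * q\<^sup>2 + 160/49 * q + 256/49"
      unfolding power2_sum power_mult_distrib power_divide by simp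
    have "16/7 * (5/7 * q + 16/7) + 8/7 * T \<le> (5/7 * q + 16/7)\<^sup>2"
      unfolding e using q0 q2 T0 by argo
    then show "16/7 * (5/7 * sqrt (t * T) + 16/7) + 8/7 * T \<le> (5/7 * sqrt (t * T) + 16/7)\<^sup>2"
      unfolding q_def .
    show "16/7 \<le> 5/7 * sqrt (t * T) + 16/7" "0 \<le> 5/7 * sqrt (t * T) + 16/7"
      using q0 unfolding q_def by linarith+
  qed
  then have "- Y \<le> sqrt (t * T) + 16/5" using 1 unfolding Y_def by linarith
  then show ?thesis by (simp add: Y_def T_def sum_subtractf)
qed

section \<open>Symmetrization and covering\<close>

lemma avg_cong: "(\<And>i. i < m \<Longrightarrow> v i = w i) \<Longrightarrow> avg m v = avg m w"
  by (simp add: avg_def)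

lemma ssd_cong: "(\<And>i. i < m \<Longrightarrow> v i = w i) \<Longrightarrow> ssd m v = ssd m w"
  unfolding ssd_def by (metis (no_types, lifting) avg_cong lessThan_iff sum.cong)

lemma exceeds_cong:
  assumes vw: "\<And>k. k < 2 * n \<Longrightarrow> v k = w k"
  shows "exceeds n t v \<longleftrightarrow> exceeds n t w"
proof -
  have "ssd n v = ssd n w" "ssd (2 * n) v = ssd (2 * n) w" "gap n v = gap n w"
    using vw by (auto simp: gap_def intro!: ssd_cong arg_cong2[where f = minus] avg_cong)
  then show ?thesis by (simp add: exceeds_def)
qed

lemma continuous_on_avg [continuous_intros]:
  "(\<And>i. continuous_on U (\<lambda>x. f x i)) \<Longrightarrow> continuous_on U (\<lambda>x. avg m (f x))"
  unfolding avg_def divide_inverse by (intro continuous_intros)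

lemma continuous_on_ssd [continuous_intros]:
  "(\<And>i. continuous_on U (\<lambda>x. f x i)) \<Longrightarrow> continuous_on U (\<lambda>x. ssd m (f x))"
  unfolding ssd_def by (intro continuous_intros)

lemma open_exceeds: "open {v. exceeds n t v}"
  unfolding exceeds_def gap_def
  by (intro open_Collect_less continuous_intros continuous_on_product_coordinates)

text \<open>A strict inequality between continuous functions defines an open set of vectors. The
  true mean does not enter it, hence the factor \<open>UNIV\<close>.\<close>

lemma exceeds_event:
  assumes "sample_events_measurable M F (2 * n)"
  shows "{z \<in> space (sample_measure M (2 * n)). \<exists>f\<in>F. exceeds n t (\<lambda>k. f (z k))}
    \<in> sets (sample_measure M (2 * n))"
proof -
  have "exceeds n t (\<lambda>k. if k < 2 * n then f (z k) else 0) \<longleftrightarrow> exceeds n t (\<lambda>k. f (z k))"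
    for f :: "'a \<Rightarrow> real" and z
    by (rule exceeds_cong) simp
  moreover have "open ((UNIV :: real set) \<times> {v. exceeds n t v})"
    by (intro open_Times open_UNIV open_exceeds)
  ultimately show ?thesis
    using assms unfolding sample_events_measurable_def by fastforce
qed

section \<open>Finite covers on a sample\<close>

lemma ex_cover_card_le:
  assumes "covering_number m \<epsilon> A \<le> enat N"
  obtains C where "finite C" "card C \<le> N" "linf_covers m \<epsilon> C A"
proof (rule ccontr)
  assume "\<not> thesis"
  with that have "enat (Suc N) \<le> enat (card C)" if "finite C \<and> linf_covers m \<epsilon> C A" for C
    using that by (simp add: Suc_le_eq) (meson not_le)
  then have "enat (Suc N) \<le> covering_number m \<epsilon> A"
    unfolding covering_number_def by (intro INF_greatest) auto
  from order_trans[OF this assms] show False by simp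
qed

text \<open>Finiteness of the growth function makes \<open>the_enat\<close> faithful. Centres belong
  to the class on the sample, hence have values in the unit interval.\<close>

lemma ex_sample_cover:
  assumes m: "m > 0" and \<epsilon>: "\<epsilon> > 0" and F: "F \<subseteq> S \<rightarrow> {0..1}"
    and x: "x \<in> {..<m} \<rightarrow>\<^sub>E S"
  obtains C where "finite C" "card C \<le> the_enat (growth_function S \<epsilon> F m)"
    "\<And>a k. a \<in> C \<Longrightarrow> k < m \<Longrightarrow> a k \<in> {0..1}"
    "\<And>f. f \<in> F \<Longrightarrow> \<exists>a\<in>C. \<forall>k<m. \<bar>a k - f (x k)\<bar> \<le> \<epsilon>"
proof -
  have F01: "f z \<in> {0..1}" if "f \<in> F" "z \<in> S" for f z
    using F that by (blast dest: funcset_mem)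
  let ?A = "class_on_sample m F x"
  have "covering_number m \<epsilon> ?A \<le> growth_function S \<epsilon> F m"
    unfolding growth_function_def using x by (rule SUP_upper)
  also have "\<dots> = enat (the_enat (growth_function S \<epsilon> F m))"
    using growth_function_finite[where F = F and S = S, OF m \<epsilon>] F01 by (cases "growth_function S \<epsilon> F m") auto
  finally obtain C where C: "finite C" "card C \<le> the_enat (growth_function S \<epsilon> F m)" "linf_covers m \<epsilon> C ?A"
    by (rule ex_cover_card_le)
  show ?thesis
  proof (rule that[OF C(1,2)])
    fix a k assume "a \<in> C" and k: "k < m"
    then have "a \<in> ?A" using C(3) by (auto simp: linf_covers_def)
    then obtain f where "f \<in> F" "a k = f (x k)" using k by (auto simp: class_on_sample_def)
    moreover have "x k \<in> S" using PiE_mem[OF x] k by simp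
    ultimately show "a k \<in> {0..1}" using F01 by metis
  next
    fix f assume f: "f \<in> F"
    let ?v = "\<lambda>i\<in>{..<m}. f (x i)"
    have "?v \<in> ?A" using f by (auto simp: class_on_sample_def)
    then obtain a where a: "a \<in> C" "linf_dist m a ?v \<le> \<epsilon>"
      using C(3) by (auto simp: linf_covers_def)
    have "\<forall>k\<in>{..<m}. \<bar>a k - ?v k\<bar> \<le> \<epsilon>"
      using a(2) m unfolding linf_dist_def by (subst (asm) Max_le_iff) (auto simp del: restrict_apply)
    then show "\<exists>a\<in>C. \<forall>k<m. \<bar>a k - f (x k)\<bar> \<le> \<epsilon>" using a(1) by auto
  qed
qed

text \<open>This ensures \<open>\<M> / \<delta> \<ge> 10\<close>, hence
  \<open>t \<ge> ln 10 \<ge> 9/4\<close>.\<close>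

lemma growth_function_ge_1:
  assumes m: "m > 0" and \<epsilon>: "\<epsilon> > 0" and F: "F \<subseteq> S \<rightarrow> {0..1}"
    and ne: "F \<noteq> {}" "S \<noteq> {}"
  shows "the_enat (growth_function S \<epsilon> F m) \<ge> 1"
proof -
  obtain x where x: "x \<in> {..<m} \<rightarrow>\<^sub>E S" using ne(2) by (metis PiE_eq_empty_iff ex_in_conv)
  obtain C where "finite C" and C: "card C \<le> the_enat (growth_function S \<epsilon> F m)"
    and "\<And>a k. a \<in> C \<Longrightarrow> k < m \<Longrightarrow> a k \<in> {0..1}"
    and "\<And>f. f \<in> F \<Longrightarrow> \<exists>a\<in>C. \<forall>k<m. \<bar>a k - f (x k)\<bar> \<le> \<epsilon>"
    by (rule ex_sample_cover[OF m \<epsilon> F x]) blast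
  then have "card C \<ge> 1" using ne(1) by (auto simp: Suc_le_eq card_gt_0_iff)
  with C show ?thesis by linarith
qed

section \<open>Averaging over swaps\<close>

lemma emeasure_swap:
  assumes M: "prob_space M" and E: "E \<in> sets (sample_measure M (2 * n))"
  shows "(\<lambda>z. \<lambda>k\<in>{..<2 * n}. z (swap n A k)) \<in> measurable (sample_measure M (2 * n)) (sample_measure M (2 * n))"
    and "emeasure (sample_measure M (2 * n))
      {z \<in> space (sample_measure M (2 * n)). (\<lambda>k\<in>{..<2 * n}. z (swap n A k)) \<in> E}
     = emeasure (sample_measure M (2 * n)) E"
proof -
  let ?P = "sample_measure M (2 * n)" and ?g = "\<lambda>z. \<lambda>k\<in>{..<2 * n}. z (swap n A k)"
  show g: "?g \<in> measurable ?P ?P"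
    by (intro measurable_restrict measurable_component_singleton) (auto simp: swap_less)
  \<comment> \<open>Exchangeability of i.i.d. coordinates: an injective reindexing preserves the
    product measure.\<close>
  have "distr ?P ?P ?g = ?P"
    by (rule distr_PiM_reindex) (auto simp: M swap_less inj_on_subset[OF inj_swap])
  then have "emeasure ?P E = emeasure (distr ?P ?P ?g) E" by simp
  also have "\<dots> = emeasure ?P (?g -` E \<inter> space ?P)" using g E by (rule emeasure_distr)
  also have "?g -` E \<inter> space ?P = {z \<in> space ?P. ?g z \<in> E}" by auto
  finally show "emeasure ?P {z \<in> space ?P. ?g z \<in> E} = emeasure ?P E" by simp
qed

text \<open>All events \<open>G A\<close> are as likely as \<open>E\<close>, so averaging over
  \<open>A\<close> and exchanging sum and integral reduces the claim to counting swaps of one fixed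
  double sample.\<close>

lemma measure_exceeds_le:
  assumes M: "prob_space M" and F: "F \<subseteq> space M \<rightarrow> {0..1}"
    and meas: "sample_events_measurable M F (2 * n)"
    and n: "n \<ge> 16" and t: "9 / 4 \<le> t" "t \<le> real n"
  shows "measure (sample_measure M (2 * n))
      {z \<in> space (sample_measure M (2 * n)). \<exists>f\<in>F. exceeds n t (\<lambda>k. f (z k))}
    \<le> 2 * real (the_enat (growth_function (space M) (1 / real n) F (2 * n))) * exp (- t)"
proof -
  let ?P = "sample_measure M (2 * n)"
  interpret P: prob_space ?P by (intro prob_space_PiM M)
  define N where "N = the_enat (growth_function (space M) (1 / real n) F (2 * n))"
  define E where "E = {z \<in> space ?P. \<exists>f\<in>F. exceeds n t (\<lambda>k. f (z k))}"
  define g where "g A z = (\<lambda>k\<in>{..<2 * n}. z (swap n A k))" for A and z :: "nat \<Rightarrow> 'a"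
  have E: "E \<in> sets ?P" unfolding E_def by (rule exceeds_event[OF meas])
  have g[measurable]: "g A \<in> measurable ?P ?P" for A
    unfolding g_def by (rule emeasure_swap(1)[OF M E])
  define G where "G A = {z \<in> space ?P. g A z \<in> E}" for A
  have G[measurable]: "G A \<in> sets ?P" for A
    unfolding G_def using E by measurable
  have meas_G: "P.prob (G A) = P.prob E" for A
    using emeasure_swap(2)[OF M E] by (simp add: measure_def G_def g_def)
  have "(\<Sum>A\<in>Pow {..<n}. indicator (G A) z) \<le> real N * (2 * (2 ^ n * exp (- t)))"
    if z: "z \<in> space ?P" for z
  proof -
    have zE: "z \<in> {..<2 * n} \<rightarrow>\<^sub>E space M" using z by (simp add: space_PiM)
    obtain C where C: "finite C" "card C \<le> N"
      and C01: "\<And>a k. a \<in> C \<Longrightarrow> k < 2 * n \<Longrightarrow> a k \<in> {0..1}"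
      and cov: "\<And>f. f \<in> F \<Longrightarrow> \<exists>a\<in>C. \<forall>k<2 * n. \<bar>a k - f (z k)\<bar> \<le> 1 / real n"
      
      unfolding N_def by (rule ex_sample_cover[OF _ _ F zE, where \<epsilon> = "1 / real n"]) (use n in auto)
    have ex: "exceeds n t (\<lambda>k. f (g A z k)) \<longleftrightarrow> exceeds n t (\<lambda>k. f (z (swap n A k)))" for f A
      by (rule exceeds_cong) (simp add: g_def)
    have "z \<in> G A \<longleftrightarrow> (\<exists>v\<in>(\<lambda>f k. f (z k)) ` F. exceeds n t (\<lambda>k. v (swap n A k)))" for A
      using z measurable_space[OF g z] by (simp add: G_def E_def ex)
    then have "(\<Sum>A\<in>Pow {..<n}. indicator (G A) z) =
        real (card {A\<in>Pow {..<n}. \<exists>v\<in>(\<lambda>f k. f (z k)) ` F. exceeds n t (\<lambda>k. v (swap n A k))})"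
      by (simp add: indicator_def sum.If_cases Int_def del: Pow_iff)
    also have "\<dots> \<le> real (card C) * (2 * (2 ^ n * exp (- t)))"
      by (rule card_exceeds_le[OF n t C(1)]) (use C01 cov in auto)
    also have "\<dots> \<le> real N * (2 * (2 ^ n * exp (- t)))"
      using C(2) by (intro mult_right_mono) auto
    finally show ?thesis .
  qed
  then have "(\<integral>z. (\<Sum>A\<in>Pow {..<n}. indicator (G A) z) \<partial>?P) \<le> (\<integral>z. real N * (2 * (2 ^ n * exp (- t))) \<partial>?P)"
    by (intro integral_mono) (auto intro!: Bochner_Integration.integrable_sum integrable_real_indicator simp: P.emeasure_finite less_top[symmetric])
  also have "(\<integral>z. (\<Sum>A\<in>Pow {..<n}. indicator (G A) z) \<partial>?P) = (\<Sum>A\<in>Pow {..<n}. P.prob (G A))"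
    by (subst Bochner_Integration.integral_sum)
       (auto intro!: integrable_real_indicator simp: P.emeasure_finite less_top[symmetric])
  also have "\<dots> = 2 ^ n * P.prob E" by (simp add: meas_G card_Pow)
  also have "(\<integral>z. real N * (2 * (2 ^ n * exp (- t))) \<partial>?P) = 2 ^ n * (2 * real N * exp (- t))"
    by (simp add: P.prob_space)
  finally show ?thesis unfolding E_def N_def by simp
qed

section \<open>From the symmetrized event to the empirical Bernstein bound\<close>

lemma ln_10_ge: "ln (10 :: real) \<ge> 9/4"
proof -
  \<comment> \<open>Fourth powers reduce the claim to \<open>(272/100)^9 \<le> 10^4\<close>.\<close>
  have "exp (9/4 :: real) ^ 4 = exp 1 ^ 9" by (simp flip: exp_of_nat_mult)
  also have "\<dots> \<le> (272/100) ^ 9" using e_less_272 by (intro power_mono) auto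
  also have "\<dots> \<le> (10::real) ^ 4" by (simp add: power_divide)
  finally have "exp (9/4 :: real) \<le> 10" by (rule power_mono_iff[THEN iffD1, rotated 3]) auto
  then show ?thesis by (subst ln_ge_iff) simp_all
qed

text \<open>\<open>p\<close> stands for the true mean; as a free argument it makes the failures an
  open set of pairs, as \<open>sample_events_measurable\<close> requires.\<close>

definition empirical_bernstein_fails :: "nat \<Rightarrow> real \<Rightarrow> real \<Rightarrow> (nat \<Rightarrow> real) \<Rightarrow> bool"
  where "empirical_bernstein_fails n t p v \<longleftrightarrow>
    sqrt (18 * (ssd n v / (real n - 1)) * t / real n) + 15 * t / (real n - 1) < p - avg n v"

lemma empirical_bernstein_fails_cong:
  assumes "\<And>k. k < n \<Longrightarrow> v k = w k"
  shows "empirical_bernstein_fails n t p v \<longleftrightarrow> empirical_bernstein_fails n t p w"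
  unfolding empirical_bernstein_fails_def using assms by (simp cong: avg_cong ssd_cong)

lemma open_empirical_bernstein_fails: "open {(p, v). empirical_bernstein_fails n t p v}"
proof -
  have "continuous_on UNIV (\<lambda>x :: real \<times> (nat \<Rightarrow> real). snd x i)" for i
    by (rule continuous_on_product_then_coordinatewise) (intro continuous_intros)
  then show ?thesis
    unfolding empirical_bernstein_fails_def case_prod_beta divide_inverse
    by (intro open_Collect_less continuous_intros)
qed

text \<open>Multiply the failure by \<open>n\<close>; then \<open>n / (n - 1) \<ge> 1\<close>
  disposes of the denominators.\<close>

lemma empirical_bernstein_fails_imp_exceeds:
  assumes n: "n \<ge> 16" and t: "t \<ge> 9/4"
    and fails: "empirical_bernstein_fails n t p v"
    and ghost: "real n * p \<le> (\<Sum>i<n. v (n + i)) + sqrt (t * ssd (2 * n) v) + 16/5"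
  shows "exceeds n t v"
proof -
  let ?W = "ssd n v"
  have "sqrt (18 * t * ?W) \<le> sqrt (18 * (?W / (real n - 1)) * t / real n * (real n)\<^sup>2)"
  proof -
    have "18 * t * ?W * 1 \<le> 18 * t * ?W * (real n / (real n - 1))"
      using n t ssd_nonneg[of n v] by (intro mult_left_mono) auto
    moreover have "0 \<le> t * (real n * ?W)" using t by (simp add: ssd_nonneg)
    ultimately show ?thesis using n by (simp add: power2_eq_square field_simps)
  qed
  also have "\<dots> = real n * sqrt (18 * (?W / (real n - 1)) * t / real n)"
    unfolding real_sqrt_mult[of _ "(real n)\<^sup>2"] real_sqrt_abs by simp
  finally have 1: "sqrt (18 * t * ?W) \<le> real n * sqrt (18 * (?W / (real n - 1)) * t / real n)" .
  have "15 * t * 1 \<le> 15 * t * (real n / (real n - 1))"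
    using n t by (intro mult_left_mono) auto
  then have 2: "15 * t \<le> real n * (15 * t / (real n - 1))" by (simp add: mult_ac)
  have "real n * (sqrt (18 * (?W / (real n - 1)) * t / real n) + 15 * t / (real n - 1)) < real n * (p - avg n v)"
    using fails n unfolding empirical_bernstein_fails_def by (intro mult_strict_left_mono) auto
  then have "sqrt (18 * t * ?W) + 15 * t < real n * p - real n * avg n v"
    using 1 2 by (simp only: distrib_left right_diff_distrib)
  moreover have "real n * gap n v = (\<Sum>i<n. v (n + i)) - real n * avg n v"
    using n by (simp add: gap_def avg_def right_diff_distrib)
  ultimately show ?thesis using ghost unfolding exceeds_def by linarith
qed

text \<open>Fubini over sample and ghost sample: above each failing \<open>x\<close> the section of
  the event on the right has probability at least \<open>1/5\<close>.\<close>

lemma measure_fails_le_exceeds: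
  assumes M: "prob_space M"
    and F: "F \<subseteq> space M \<rightarrow> {0..1}"
    and Fm: "\<And>f. f \<in> F \<Longrightarrow> f \<in> borel_measurable M"
    and n: "n \<ge> 16" and t: "t \<ge> 9/4"
    and B: "{x \<in> space (sample_measure M n).
      \<exists>f\<in>F. empirical_bernstein_fails n t (true_mean f M) (\<lambda>i. f (x i))} \<in> sets (sample_measure M n)"
    and E: "{z \<in> space (sample_measure M (2 * n)). \<exists>f\<in>F. exceeds n t (\<lambda>k. f (z k))}
      \<in> sets (sample_measure M (2 * n))"
  shows "measure (sample_measure M n)
      {x \<in> space (sample_measure M n).
        \<exists>f\<in>F. empirical_bernstein_fails n t (true_mean f M) (\<lambda>i. f (x i))}
    \<le> 5 * measure (sample_measure M (2 * n))
      {z \<in> space (sample_measure M (2 * n)). \<exists>f\<in>F. exceeds n t (\<lambda>k. f (z k))}"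
    (is "measure ?P ?B \<le> 5 * measure ?PP ?E")
proof -
  interpret M: prob_space M by (rule M)
  interpret product_prob_space "\<lambda>_. M" by standard
  let ?J = "{n..<2 * n}"
  let ?Q = "PiM ?J (\<lambda>_. M)"
  interpret Pn: prob_space ?P by (intro prob_space_PiM M)
  interpret PP: prob_space ?PP by (intro prob_space_PiM M)
  interpret Q: prob_space ?Q by (intro prob_space_PiM M)
  have IJ: "{..<2 * n} = {..<n} \<union> ?J" "{..<n} \<inter> ?J = {}" by auto
  let ?S = "\<lambda>x. (\<lambda>y. merge {..<n} ?J (x, y)) -` ?E \<inter> space ?Q"
  have sum_J: "(\<Sum>i\<in>?J. h i) = (\<Sum>i<n. h (n + i))" for h :: "nat \<Rightarrow> real"
    by (rule sum.reindex_bij_witness[of _ "\<lambda>i. n + i" "\<lambda>i. i - n"]) auto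
  have "ennreal (1/5) \<le> emeasure ?Q (?S x)" if x: "x \<in> ?B" for x
  proof -
    \<comment> \<open>\<open>f\<close> depends on \<open>x\<close> only, so it is fixed while the
      ghost sample is drawn and the estimate for a single function applies.\<close>
    from x obtain f where f: "f \<in> F" and xs: "x \<in> space ?P"
      and fails: "empirical_bernstein_fails n t (true_mean f M) (\<lambda>i. f (x i))" by auto
    define s where "s = sqrt (real (card ?J) * (\<integral>z. (f z - true_mean f M)\<^sup>2 \<partial>M))"
    have s0: "s \<ge> 0" by (auto simp: s_def intro!: mult_nonneg_nonneg integral_nonneg)
    let ?G = "{y \<in> space ?Q. \<bar>\<Sum>i\<in>?J. f (y i) - true_mean f M\<bar> \<le> 7/5 * s \<and>
        s\<^sup>2 - 2 * s \<le> (\<Sum>i\<in>?J. (f (y i) - true_mean f M)\<^sup>2)}"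
    have "1/5 \<le> Q.prob ?G"
      unfolding s_def
    proof (rule ghost_sample_prob_ge[OF M _ Fm[OF f]])
      show "f z \<in> {0..1}" if "z \<in> space M" for z using F f that by (blast dest: funcset_mem)
    qed simp
    also have "?G \<subseteq> ?S x"
    proof (rule subsetI)
      fix y assume "y \<in> ?G"
      then have y: "y \<in> space ?Q"
        and 1: "\<bar>\<Sum>i\<in>?J. f (y i) - true_mean f M\<bar> \<le> 7/5 * s"
        and 2: "s\<^sup>2 - 2 * s \<le> (\<Sum>i\<in>?J. (f (y i) - true_mean f M)\<^sup>2)" by auto
      define z where "z = merge {..<n} ?J (x, y)"
      have z1: "z i = x i" and z2: "z (n + i) = y (n + i)" if "i < n" for i
        using that by (auto simp: z_def merge_def)
      have "exceeds n t (\<lambda>k. f (z k))"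
      proof (rule empirical_bernstein_fails_imp_exceeds[OF n t])
        show "empirical_bernstein_fails n t (true_mean f M) (\<lambda>k. f (z k))"
          using fails by (rule empirical_bernstein_fails_cong[THEN iffD1, rotated]) (simp add: z1)
        show "real n * true_mean f M \<le> (\<Sum>i<n. f (z (n + i))) + sqrt (t * ssd (2 * n) (\<lambda>k. f (z k))) + 16/5"
          by (rule mean_le_of_ghost[where v = "\<lambda>k. f (z k)", OF n t s0]) (use 1 2 in \<open>simp_all add: sum_J z2\<close>)
      qed
      moreover have "z \<in> space ?PP"
        using xs y unfolding z_def IJ(1) by (auto simp: space_PiM PiE_iff merge_def extensional_def)
      ultimately show "y \<in> ?S x" using f y by (auto simp: z_def)
    qed
    then have "Q.prob ?G \<le> Q.prob (?S x)"
    proof (rule Q.finite_measure_mono)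
      have "(\<lambda>y. merge {..<n} ?J (x, y)) \<in> measurable ?Q ?PP"
        unfolding IJ(1) by (rule measurable_compose[OF measurable_Pair1'[OF xs] measurable_merge])
      then show "?S x \<in> sets ?Q" using E by (rule measurable_sets)
    qed
    finally show ?thesis by (simp add: Q.emeasure_eq_measure)
  qed
  then have "(\<integral>\<^sup>+x. ennreal (1/5) * indicator ?B x \<partial>?P) \<le> (\<integral>\<^sup>+x. emeasure ?Q (?S x) \<partial>?P)"
    by (intro nn_integral_mono) (auto split: split_indicator)
  also have "\<dots> = emeasure ?PP ?E"
    using E unfolding IJ(1) by (intro emeasure_fold_integral[symmetric] IJ(2)) auto
  finally have "ennreal (1/5) * emeasure ?P ?B \<le> emeasure ?PP ?E"
    using B by (simp add: nn_integral_cmult_indicator)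
  then show ?thesis
    by (simp add: Pn.emeasure_eq_measure PP.emeasure_eq_measure flip: ennreal_mult')
qed

theorem theorem6:
  fixes M :: "'a measure" and F :: "('a \<Rightarrow> real) set" and n :: nat and \<delta> \<M> :: real
  assumes "prob_space M"
    and "\<And>f z. f \<in> F \<Longrightarrow> z \<in> space M \<Longrightarrow> f z \<in> {0..1}"
    and "\<And>f. f \<in> F \<Longrightarrow> f \<in> borel_measurable M"
    and "sample_events_measurable M F n" and "sample_events_measurable M F (2 * n)"
    and "0 < \<delta>" and "\<delta> < 1" and "n \<ge> 16"
    and "\<M> = 10 * real (the_enat (growth_function (space M) (1 / real n) F (2 * n)))"
  shows "measure (sample_measure M n)
      {x \<in> space (sample_measure M n). \<forall>f\<in>F.
        true_mean f M - emp_mean n f x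
          \<le> sqrt (18 * emp_var n f x * ln (\<M> / \<delta>) / real n) + 15 * ln (\<M> / \<delta>) / (real n - 1)}
    \<ge> 1 - \<delta>"
proof -
  note M = assms(1) and F = assms(2) and Fm = assms(3) and n = assms(8)
  have FI: "F \<subseteq> space M \<rightarrow> {0..1}" using F by auto
  let ?P = "sample_measure M n"
  interpret M: prob_space M by (rule M)
  interpret P: prob_space ?P by (intro prob_space_PiM M)
  define N where "N = the_enat (growth_function (space M) (1 / real n) F (2 * n))"
  define t where "t = ln (\<M> / \<delta>)"
  define B where "B = {x \<in> space ?P. \<exists>f\<in>F. empirical_bernstein_fails n t (true_mean f M) (\<lambda>i. f (x i))}"
  have fails: "empirical_bernstein_fails n t p (\<lambda>i. f (x i)) \<longleftrightarrow>
      \<not> p - emp_mean n f x \<le> sqrt (18 * emp_var n f x * t / real n) + 15 * t / (real n - 1)" for p f x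
    using n by (simp add: empirical_bernstein_fails_def emp_var_eq_ssd emp_mean_def avg_def not_le)
  have G: "{x \<in> space ?P. \<forall>f\<in>F. true_mean f M - emp_mean n f x
      \<le> sqrt (18 * emp_var n f x * t / real n) + 15 * t / (real n - 1)} = space ?P - B"
    unfolding B_def fails by auto
  have B: "B \<in> sets ?P"
  proof -
    have "empirical_bernstein_fails n t p (\<lambda>i. if i < n then f (x i) else 0) \<longleftrightarrow>
        empirical_bernstein_fails n t p (\<lambda>i. f (x i))" for p and f :: "'a \<Rightarrow> real" and x
      by (rule empirical_bernstein_fails_cong) simp
    moreover have "{x \<in> space ?P. \<exists>f\<in>F. (true_mean f M, \<lambda>i. if i < n then f (x i) else 0)
        \<in> {(p, v). empirical_bernstein_fails n t p v}} \<in> sets ?P"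
      using assms(4) open_empirical_bernstein_fails[of n t]
      unfolding sample_events_measurable_def by blast
    ultimately show ?thesis by (simp add: B_def)
  qed
  have "P.prob B \<le> \<delta>"
  \<comment> \<open>In these cases failure is impossible: there is no \<open>f\<close>, or
    \<open>15 * t / (n - 1)\<close> alone exceeds \<open>1\<close>. Otherwise the bounds
    \<open>9/4 \<le> t \<le> n\<close> hold.\<close>
  proof (cases "F = {} \<or> t > real n")
    case True
    have "\<not> empirical_bernstein_fails n t (true_mean f M) (\<lambda>i. f (x i))"
      if f: "f \<in> F" and x: "x \<in> space ?P" for f x
    proof -
      have "x i \<in> space M" if "i < n" for i using x that by (auto simp: space_PiM)
      then have "avg n (\<lambda>i. f (x i)) \<in> {0..1}" using F[OF f] n by (intro avg_mem_unit) auto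
      moreover have "true_mean f M \<le> 1"
      proof -
        have "true_mean f M \<le> (\<integral>z. 1 \<partial>M)"
        proof (rule integral_mono)
          show "integrable M f"
            by (rule M.integrable_const_bound[where B = 1]) (use F[OF f] Fm[OF f] in auto)
        qed (use F[OF f] in auto)
        then show ?thesis by (simp add: M.prob_space)
      qed
      moreover have tn: "t > real n" using True f by auto
      then have "1 \<le> 15 * t / (real n - 1)" using n by (simp add: field_simps)
      moreover have "sqrt (18 * (ssd n (\<lambda>i. f (x i)) / (real n - 1)) * t / real n) \<ge> 0"
        using n tn by (simp add: ssd_nonneg)
      ultimately show ?thesis
        unfolding empirical_bernstein_fails_def not_less atLeastAtMost_iff by linarith
    qed
    then have "B = {}" by (auto simp: B_def)
    then show ?thesis using assms(6) by simp
  next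
    case False
    then have N: "N \<ge> 1"
      unfolding N_def using n M.not_empty
      by (intro growth_function_ge_1 FI) auto
    have "10 * \<delta> \<le> \<M>" using N assms(7) by (simp add: assms(9) N_def)
    then have "10 \<le> \<M> / \<delta>" using assms(6) by (simp add: pos_le_divide_eq)
    then have pos: "\<M> / \<delta> > 0" and "ln 10 \<le> t"
      by (auto simp: t_def)
    then have t: "t \<ge> 9/4" using ln_10_ge by linarith
    have "P.prob B \<le> 5 * measure (sample_measure M (2 * n))
        {z \<in> space (sample_measure M (2 * n)). \<exists>f\<in>F. exceeds n t (\<lambda>k. f (z k))}"
      using B unfolding B_def
      by (intro measure_fails_le_exceeds[OF M FI Fm n t _ exceeds_event[OF assms(5)]])
    also have "\<dots> \<le> 5 * (2 * real N * exp (- t))"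
      unfolding N_def using False
      by (intro mult_left_mono measure_exceeds_le[OF M FI assms(5) n t]) auto
    also have "\<dots> = \<M> * exp (- t)" by (simp add: assms(9) N_def)
    also have "\<dots> = \<delta>" using pos assms(6) by (simp add: t_def exp_minus field_simps)
    finally show ?thesis .
  qed
  then show ?thesis
    using P.prob_compl[OF B] unfolding t_def[symmetric] G by simp
qed

end
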